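(* Let $u\in W^{1,2}(\mathbb{R},\mathbb{R}^m)$ be such that $$\frac{du}{dx}\cdot(-\Delta)^{1/2}u=0\quad\text{a.e. in }\mathbb{R}.$$ Assume that, for some constant $u_0\in\mathbb{R}^m$, $$\int_{\mathbb{R}}|u-u_0|\,dx<+\infty,\qquad\int_{\mathbb{R}}\left|\frac{du}{dx}(x)\right|dx<+\infty .$$ Then for every $t>0$ the following identity holds: $$\left|\int_{\mathbb{R}}\frac{x^2-t^2}{(x^2+t^2)^2}\,u(x)\,dx\right|^2=\left|\int_{\mathbb{R}}\frac{2xt}{(x^2+t^2)^2}\,u(x)\,dx\right|^2 .$$
   Context: $(-\Delta)^{1/2}$ on $\mathbb{R}$ is the Fourier multiplier with symbol $|\xi|$; $\cdot$ is the scalar product and $|\cdot|$ the Euclidean norm of $\mathbb{R}^m$. *)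

theory Defs
  imports "HOL-Analysis.Analysis"
begin

text \<open>
  Lebesgue spaces and Sobolev functions are represented by functions, not by classes modulo
  equality almost everywhere.  Weak derivatives, Fourier transforms on the space of square
  integrable functions and the half-Laplacian are determined only almost everywhere; they are
  therefore relations between a function and any representative of the result.
\<close>

definition L2 :: "(real \<Rightarrow> 'a::euclidean_space) \<Rightarrow> bool" where
  "L2 f \<longleftrightarrow> f \<in> borel_measurable lebesgue \<and> integrable lebesgue (\<lambda>x. (norm (f x))\<^sup>2)"

definition locally_integrable :: "(real \<Rightarrow> 'a::euclidean_space) \<Rightarrow> bool" where
  "locally_integrable f \<longleftrightarrow> (\<forall>K. compact K \<longrightarrow> set_integrable lebesgue K f)"

definition test_function :: "(real \<Rightarrow> real) \<Rightarrow> bool" where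
  "test_function \<phi> \<longleftrightarrow>
     (\<forall>k x. (deriv ^^ k) \<phi> field_differentiable (at x)) \<and> compact (closure {x. \<phi> x \<noteq> 0})"

definition has_weak_derivative :: "(real \<Rightarrow> 'a::euclidean_space) \<Rightarrow> (real \<Rightarrow> 'a) \<Rightarrow> bool" where
  "has_weak_derivative u v \<longleftrightarrow>
     locally_integrable u \<and> locally_integrable v \<and>
     (\<forall>\<phi>. test_function \<phi> \<longrightarrow>
        (LINT x|lebesgue. deriv \<phi> x *\<^sub>R u x) = - (LINT x|lebesgue. \<phi> x *\<^sub>R v x))"

definition sobolev_W12 :: "(real \<Rightarrow> 'a::euclidean_space) \<Rightarrow> bool" where
  "sobolev_W12 u \<longleftrightarrow> L2 u \<and> (\<exists>v. L2 v \<and> has_weak_derivative u v)"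

text \<open>
  The Fourier transform of a square integrable function, as the limit in the mean of the
  transforms of its truncations.  With the kernel \<open>exp (- \<i> x \<xi>)\<close>, without a factor
  \<open>2 \<pi>\<close> in the exponent, the operator \<open>- \<Delta>\<close> has the symbol \<open>\<xi>\<^sup>2\<close>; a normalising factor in
  front of the integral would not affect Fourier multipliers.  The distance is a nonnegative
  integral so that it cannot vanish merely because the integrand is not integrable.
\<close>

definition truncated_fourier :: "real \<Rightarrow> (real \<Rightarrow> complex) \<Rightarrow> real \<Rightarrow> complex" where
  "truncated_fourier R f \<xi> = (LINT x:{-R..R}|lebesgue. exp (- \<i> * of_real (x * \<xi>)) * f x)"

definition has_fourier_L2 :: "(real \<Rightarrow> complex) \<Rightarrow> (real \<Rightarrow> complex) \<Rightarrow> bool" where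
  "has_fourier_L2 f g \<longleftrightarrow> L2 f \<and> L2 g \<and>
     ((\<lambda>R. \<integral>\<^sup>+\<xi>. ennreal ((norm (truncated_fourier R f \<xi> - g \<xi>))\<^sup>2) \<partial>lebesgue) \<longlongrightarrow> 0) at_top"

definition has_multiplier_image ::
    "(real \<Rightarrow> real) \<Rightarrow> (real \<Rightarrow> real) \<Rightarrow> (real \<Rightarrow> real) \<Rightarrow> bool" where
  "has_multiplier_image m f w \<longleftrightarrow>
     (\<exists>g. has_fourier_L2 (\<lambda>x. of_real (f x)) g \<and>
          has_fourier_L2 (\<lambda>x. of_real (w x)) (\<lambda>\<xi>. of_real (m \<xi>) * g \<xi>))"

text \<open>
  The relation \<open>has_half_laplacian u w\<close> means that \<open>w = (- \<Delta>)\<^sup>1\<^sup>/\<^sup>2 u\<close> almost everywhere, the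
  multiplier acting on each component.  By Plancherel's theorem every \<open>u\<close> in
  \<open>W\<^sup>1\<^sup>,\<^sup>2\<close> has such a \<open>w\<close>, and it is unique almost everywhere.
\<close>

definition has_half_laplacian :: "(real \<Rightarrow> real ^ 'm) \<Rightarrow> (real \<Rightarrow> real ^ 'm) \<Rightarrow> bool" where
  "has_half_laplacian u w \<longleftrightarrow>
     (\<forall>i. has_multiplier_image (\<lambda>\<xi>. \<bar>\<xi>\<bar>) (\<lambda>x. u x $ i) (\<lambda>x. w x $ i))"

end

theory Submission
  imports Defs
begin

text \<open>
  Let \<open>v\<close> be the weak derivative of \<open>u\<close> and \<open>w\<close> its half-Laplacian.  On the Fourier side the function
  \<open>h = v + \<i> w\<close>, formed in each component, is \<open>\<i> (\<xi> + \<bar>\<xi>\<bar>)\<close> times the transform of \<open>u\<close>, so it lives on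
  the positive half-line: every component \<open>h\<^sub>i\<close> is the boundary value of a function in the Hardy space
  of the upper half-plane.  A product of two such boundary values is again one, of an integrable
  Hardy function.  The imaginary part of the complex bilinear square \<open>q = \<Sum>\<^sub>i h\<^sub>i\<^sup>2\<close> is \<open>2 v \<bullet> w = 0\<close>,
  and an integrable Hardy function with real boundary values vanishes.  So the sum of the squares
  of the holomorphic extensions vanishes in the half-plane.  At \<open>\<i> t\<close> the extension of \<open>h\<^sub>i\<close> is a
  multiple of \<open>A\<^sub>i + \<i> B\<^sub>i\<close>, where \<open>A\<close> and \<open>B\<close> are the two vectors of the statement, because
  \<open>1 / (x - \<i> t)\<^sup>2\<close> has real part \<open>(x\<^sup>2 - t\<^sup>2) / (x\<^sup>2 + t\<^sup>2)\<^sup>2\<close> and imaginary part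
  \<open>2 x t / (x\<^sup>2 + t\<^sup>2)\<^sup>2\<close>; hence \<open>\<bar>A\<bar>\<^sup>2 - \<bar>B\<bar>\<^sup>2 + 2 \<i> A \<bullet> B = 0\<close>.

  The proof expresses all of this through the Cauchy transform
  \<open>C f z = \<integral> f x / (x - z) dx\<close>, without Plancherel's theorem or Fourier inversion.  Being a
  boundary value from the upper half-plane means that \<open>C f\<close> vanishes in the lower half-plane.

  \<^item> \<open>cauchy_transform_mult\<close>: for such \<open>f\<close> and \<open>g\<close> in \<open>L\<^sup>2\<close>, \<open>2 \<pi> \<i> C (f g) = C f \<cdot> C g\<close> off the real line.
    Partial fractions give the formula with \<open>g\<close> smoothed by the Poisson kernel, and the smoothing is
    removed with the continuity of translations in \<open>L\<^sup>2\<close>.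
  \<^item> \<open>half_laplacian_cauchy_kernel\<close>: pairing the \<open>L\<^sup>2\<close> limit that defines the Fourier transform with
    \<open>e\<^bsup>\<i>p\<xi>\<^esup>\<close> and \<open>\<xi> e\<^bsup>\<i>p\<xi>\<^esup>\<close> on the positive half-line, where \<open>\<bar>\<xi>\<bar> = \<xi>\<close>, gives
    \<open>C w p = - \<i> \<integral> u x / (x - p)\<^sup>2 dx\<close> for \<open>Im p > 0\<close>.
  \<^item> \<open>weak_derivative_cauchy_kernel\<close>: integration by parts gives \<open>C v p = \<integral> u x / (x - p)\<^sup>2 dx\<close>.
    Together with the previous item and complex conjugation, \<open>C h\<close> vanishes below the real line
    and is \<open>2 \<integral> u x / (x - p)\<^sup>2 dx\<close> above it (\<open>hardy_boundary_function\<close>).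
  \<^item> \<open>weak_derivative_unique\<close> makes the given weak derivative the square integrable one.
\<close>

section \<open>Square integrable complex functions\<close>

definition square_integrable :: "'a measure \<Rightarrow> ('a \<Rightarrow> complex) \<Rightarrow> bool" where
  "square_integrable M f \<longleftrightarrow> f \<in> borel_measurable M \<and> integrable M (\<lambda>x. (norm (f x))\<^sup>2)"

lemma square_integrable_measurable [measurable_dest]:
  "square_integrable M f \<Longrightarrow> f \<in> borel_measurable M"
  by (simp add: square_integrable_def)

lemma square_integrable_norm2:
  "square_integrable M f \<Longrightarrow> integrable M (\<lambda>x. (norm (f x))\<^sup>2)"
  by (simp add: square_integrable_def)

lemma norm_mult_le_squares: "norm (a * b :: complex) \<le> ((norm a)\<^sup>2 + (norm b)\<^sup>2) / 2"
  using sum_squares_bound[of "norm a" "norm b"] by (simp add: norm_mult)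

lemma norm_add_le_squares: "(norm (a + b :: complex))\<^sup>2 \<le> 2 * (norm a)\<^sup>2 + 2 * (norm b)\<^sup>2"
proof -
  have "(norm (a + b))\<^sup>2 \<le> (norm a + norm b)\<^sup>2"
    by (intro power_mono norm_triangle_ineq) auto
  also have "\<dots> \<le> 2 * (norm a)\<^sup>2 + 2 * (norm b)\<^sup>2"
    using sum_squares_bound[of "norm a" "norm b"] by (simp add: power2_sum)
  finally show ?thesis .
qed

lemma square_integrable_mult_bounded:
  assumes f: "square_integrable M f" and b: "b \<in> borel_measurable M"
    and B: "\<And>x. norm (b x) \<le> B"
  shows "square_integrable M (\<lambda>x. b x * f x)"
  unfolding square_integrable_def
proof
  show "integrable M (\<lambda>x. (norm (b x * f x))\<^sup>2)"
  proof (rule Bochner_Integration.integrable_bound)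
    show "integrable M (\<lambda>x. B\<^sup>2 * (norm (f x))\<^sup>2)"
      using square_integrable_norm2[OF f] by simp
    show "AE x in M. norm ((norm (b x * f x))\<^sup>2) \<le> norm (B\<^sup>2 * (norm (f x))\<^sup>2)"
      using B by (auto simp: norm_mult power_mult_distrib intro!: mult_right_mono power_mono)
  qed (use f b in measurable)
qed (use f b in measurable)

lemma square_integrable_cmult:
  "square_integrable M f \<Longrightarrow> square_integrable M (\<lambda>x. c * f x)"
  by (rule square_integrable_mult_bounded[where B = "norm c"]) auto

lemma square_integrable_add:
  assumes f: "square_integrable M f" and g: "square_integrable M g"
  shows "square_integrable M (\<lambda>x. f x + g x)"
  unfolding square_integrable_def
proof
  show "integrable M (\<lambda>x. (norm (f x + g x))\<^sup>2)"
  proof (rule Bochner_Integration.integrable_bound)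
    show "integrable M (\<lambda>x. 2 * (norm (f x))\<^sup>2 + 2 * (norm (g x))\<^sup>2)"
      using square_integrable_norm2[OF f] square_integrable_norm2[OF g] by simp
    show "AE x in M. norm ((norm (f x + g x))\<^sup>2) \<le> norm (2 * (norm (f x))\<^sup>2 + 2 * (norm (g x))\<^sup>2)"
      by (auto simp: norm_add_le_squares)
  qed (use f g in measurable)
qed (use f g in measurable)

lemma square_integrable_diff:
  assumes "square_integrable M f" "square_integrable M g"
  shows "square_integrable M (\<lambda>x. f x - g x)"
  using square_integrable_add[OF assms(1) square_integrable_cmult[OF assms(2), of "-1"]] by simp

lemma square_integrable_AE_cong:
  assumes "square_integrable M f" "AE x in M. f x = g x" "g \<in> borel_measurable M"
  shows "square_integrable M g"
  unfolding square_integrable_def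
proof
  show "integrable M (\<lambda>x. (norm (g x))\<^sup>2)"
    using square_integrable_norm2[OF assms(1)]
    by (rule integrable_cong_AE_imp) (use assms(2,3) in auto)
qed fact

lemma integrable_mult_square_integrable:
  assumes f: "square_integrable M f" and g: "square_integrable M g"
  shows "integrable M (\<lambda>x. f x * g x)"
proof (rule Bochner_Integration.integrable_bound)
  show "integrable M (\<lambda>x. ((norm (f x))\<^sup>2 + (norm (g x))\<^sup>2) / 2)"
    using square_integrable_norm2[OF f] square_integrable_norm2[OF g] by simp
  show "AE x in M. norm (f x * g x) \<le> norm (((norm (f x))\<^sup>2 + (norm (g x))\<^sup>2) / 2)"
    using norm_mult_le_squares[of "f _" "g _"] by (auto simp del: norm_mult)
qed (use f g in measurable)

lemma norm_integral_mult_le: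
  assumes f: "square_integrable M f" and g: "square_integrable M g"
  shows "(norm (LINT x|M. f x * g x))\<^sup>2
    \<le> (LINT x|M. (norm (f x))\<^sup>2) * (LINT x|M. (norm (g x))\<^sup>2)"
proof -
  have i: "integrable M (\<lambda>x. norm (f x) * norm (g x))"
    using integrable_norm[OF integrable_mult_square_integrable[OF f g]] by (simp add: norm_mult)
  have "norm (LINT x|M. f x * g x) \<le> (LINT x|M. norm (f x) * norm (g x))"
    using integral_norm_bound[of M "\<lambda>x. f x * g x"] by (simp add: norm_mult)
  then have 1: "(norm (LINT x|M. f x * g x))\<^sup>2 \<le> (LINT x|M. norm (f x) * norm (g x))\<^sup>2"
    by (intro power_mono) auto
  have "ennreal ((LINT x|M. norm (f x) * norm (g x))\<^sup>2)
      = (\<integral>\<^sup>+x. ennreal (norm (f x)) * ennreal (norm (g x)) \<partial>M)\<^sup>2"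
    by (subst ennreal_power[symmetric])
      (auto simp: nn_integral_eq_integral[OF i, symmetric] ennreal_mult'' intro!: integral_nonneg_AE)
  also have "\<dots> \<le> (\<integral>\<^sup>+x. (ennreal (norm (f x)))\<^sup>2 \<partial>M) * (\<integral>\<^sup>+x. (ennreal (norm (g x)))\<^sup>2 \<partial>M)"
    by (rule Cauchy_Schwarz_nn_integral) (use f g in measurable)
  also have "\<dots> = (\<integral>\<^sup>+x. ennreal ((norm (f x))\<^sup>2) \<partial>M) * (\<integral>\<^sup>+x. ennreal ((norm (g x))\<^sup>2) \<partial>M)"
    by (simp add: ennreal_power)
  also have "\<dots> = ennreal (LINT x|M. (norm (f x))\<^sup>2) * ennreal (LINT x|M. (norm (g x))\<^sup>2)"
    using square_integrable_norm2[OF f] square_integrable_norm2[OF g]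
    by (simp add: nn_integral_eq_integral)
  also have "\<dots> = ennreal ((LINT x|M. (norm (f x))\<^sup>2) * (LINT x|M. (norm (g x))\<^sup>2))"
    by (simp add: ennreal_mult'')
  finally have "(LINT x|M. norm (f x) * norm (g x))\<^sup>2
      \<le> (LINT x|M. (norm (f x))\<^sup>2) * (LINT x|M. (norm (g x))\<^sup>2)"
    by (subst (asm) ennreal_le_iff) (auto intro!: mult_nonneg_nonneg)
  with 1 show ?thesis by (rule order_trans)
qed

lemma square_integrable_lebesgue_iff_L2: "square_integrable lebesgue f \<longleftrightarrow> L2 f"
  by (simp add: square_integrable_def L2_def)

lemma square_integrable_lborel_imp_lebesgue:
  "square_integrable lborel f \<Longrightarrow> square_integrable lebesgue f"
  by (auto simp: square_integrable_def integrable_completion intro: measurable_completion)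

lemma square_integrable_lebesgue_imp_lborel:
  "square_integrable lebesgue f \<Longrightarrow> f \<in> borel_measurable borel \<Longrightarrow> square_integrable lborel f"
  by (auto simp: square_integrable_def integrable_completion)

section \<open>The Cauchy kernel\<close>

lemma has_integral_inverse_one_plus_square:
  shows "integrable lborel (\<lambda>y::real. 1 / (1 + y\<^sup>2))"
    and "(LINT y|lborel. 1 / (1 + y\<^sup>2)) = pi"
proof -
  have D: "DERIV arctan x :> 1 / (1 + x\<^sup>2)" for x
    using DERIV_arctan[of x] by (simp add: inverse_eq_divide)
  have c: "isCont (\<lambda>y::real. 1 / (1 + y\<^sup>2)) x" for x
    by (intro continuous_intros) (use sum_power2_gt_zero_iff[of 1 x] in auto)
  have "((arctan \<circ> real_of_ereal) \<longlongrightarrow> - (pi / 2)) (at_right (- \<infinity>))"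
    by (simp add: ereal_tendsto_simps1 tendsto_arctan_at_bot)
  moreover have "((arctan \<circ> real_of_ereal) \<longlongrightarrow> pi / 2) (at_left \<infinity>)"
    by (simp add: ereal_tendsto_simps1 tendsto_arctan_at_top)
  ultimately have "set_integrable lborel (einterval (- \<infinity>) \<infinity>) (\<lambda>y::real. 1 / (1 + y\<^sup>2))"
    and "(LBINT y=- \<infinity>..\<infinity>. 1 / (1 + y\<^sup>2)) = pi / 2 - - (pi / 2)"
    using interval_integral_FTC_nonneg[of "-\<infinity>" "\<infinity>" arctan "\<lambda>y. 1 / (1 + y\<^sup>2)"] D c
    by auto
  then show "integrable lborel (\<lambda>y::real. 1 / (1 + y\<^sup>2))"
    and "(LINT y|lborel. 1 / (1 + y\<^sup>2)) = pi"
    by (auto simp: set_integrable_def interval_lebesgue_integral_def set_lebesgue_integral_def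
        einterval_def)
qed

lemma norm_shift_square: "(norm (of_real x - z))\<^sup>2 = (x - Re z)\<^sup>2 + (Im z)\<^sup>2"
  by (simp add: cmod_power2)

lemma real_minus_complex_nonzero: "Im z \<noteq> 0 \<Longrightarrow> of_real x - z \<noteq> 0"
  by (auto simp: complex_eq_iff)

lemma norm_inverse_shift_le: "Im z \<noteq> 0 \<Longrightarrow> norm (1 / (of_real x - z)) \<le> 1 / \<bar>Im z\<bar>"
  using abs_Im_le_cmod[of "of_real x - z"] real_minus_complex_nonzero[of z x]
  by (auto simp: norm_divide intro!: divide_left_mono)

lemma integral_cauchy_kernel_square:
  assumes z: "Im z \<noteq> 0"
  shows "integrable lborel (\<lambda>x. (norm (1 / (of_real x - z)))\<^sup>2)"
    and "(LINT x|lborel. (norm (1 / (of_real x - z)))\<^sup>2) = pi / \<bar>Im z\<bar>"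
proof -
  define f where "f x = (norm (1 / (of_real x - z)))\<^sup>2" for x :: real
  have f: "f (Re z + Im z * y) = (1 / (Im z)\<^sup>2) * (1 / (1 + y\<^sup>2))" for y
  proof -
    have "(Im z * y)\<^sup>2 + (Im z)\<^sup>2 = (Im z)\<^sup>2 * (1 + y\<^sup>2)"
      by (simp add: power_mult_distrib algebra_simps)
    then show ?thesis
      unfolding f_def norm_divide power_divide norm_shift_square by simp
  qed
  show "integrable lborel (\<lambda>x. (norm (1 / (of_real x - z)))\<^sup>2)"
    using lborel_integrable_real_affine_iff[OF z, of f "Re z"]
      integrable_mult_right[OF has_integral_inverse_one_plus_square(1), of "1 / (Im z)\<^sup>2"]
    unfolding f by (simp add: f_def[abs_def])
  have "(LINT x|lborel. f x) = \<bar>Im z\<bar> * (1 / (Im z)\<^sup>2 * pi)"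
    unfolding lborel_integral_real_affine[OF z, of f "Re z"] f integral_mult_right_zero
      has_integral_inverse_one_plus_square(2) by simp
  then show "(LINT x|lborel. (norm (1 / (of_real x - z)))\<^sup>2) = pi / \<bar>Im z\<bar>"
    using z by (simp add: f_def power2_eq_square abs_if)
qed

lemma square_integrable_cauchy_kernel:
  "Im z \<noteq> 0 \<Longrightarrow> square_integrable lborel (\<lambda>x. 1 / (of_real x - z))"
  using integral_cauchy_kernel_square(1)[of z] by (auto simp: square_integrable_def)

text \<open>
  The usual factor \<open>1 / (2 \<pi> \<i>)\<close> is left out.  For \<open>f\<close> in \<open>L\<^sup>2\<close>, vanishing of the Cauchy transform in
  the lower half-plane characterises the boundary values of Hardy functions on the upper one.
\<close>
definition cauchy_transform :: "(real \<Rightarrow> complex) \<Rightarrow> complex \<Rightarrow> complex" where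
  "cauchy_transform f z = (LINT x|lborel. f x / (of_real x - z))"

lemma integrable_divide_shift:
  assumes "square_integrable lborel f" "Im z \<noteq> 0"
  shows "integrable lborel (\<lambda>x. f x / (of_real x - z))"
  using integrable_mult_square_integrable[OF assms(1) square_integrable_cauchy_kernel[OF assms(2)]]
  by simp

lemma square_integrable_divide_shift:
  assumes "square_integrable lborel f" "Im z \<noteq> 0"
  shows "square_integrable lborel (\<lambda>x. f x / (of_real x - z))"
  using square_integrable_mult_bounded[OF assms(1), of "\<lambda>x. 1 / (of_real x - z)" "1 / \<bar>Im z\<bar>"]
    norm_inverse_shift_le[OF assms(2)] by simp

lemma cauchy_transform_tendsto:
  assumes g: "square_integrable lborel g" and z: "Im z \<noteq> 0"
    and X: "X \<longlonglongrightarrow> 0" and small: "\<And>n. \<bar>X n\<bar> \<le> \<bar>Im z\<bar> / 2"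
  shows "(\<lambda>n. cauchy_transform g (z + \<i> * of_real (X n))) \<longlonglongrightarrow> cauchy_transform g z"
  unfolding cauchy_transform_def
proof (rule integral_dominated_convergence[where w = "\<lambda>s. 2 * norm (g s / (of_real s - z))"])
  note [measurable] = square_integrable_measurable[OF g]
  show "integrable lborel (\<lambda>s. 2 * norm (g s / (of_real s - z)))"
    by (intro integrable_mult_right integrable_norm integrable_divide_shift g z)
  have nz: "complex_of_real s - z \<noteq> 0" for s by (rule real_minus_complex_nonzero[OF z])
  show "AE s in lborel. (\<lambda>n. g s / (of_real s - (z + \<i> * of_real (X n)))) \<longlonglongrightarrow> g s / (of_real s - z)"
  proof (rule AE_I2)
    fix s
    have "(\<lambda>n. g s / (of_real s - (z + \<i> * of_real (X n))))
      \<longlonglongrightarrow> g s / (of_real s - (z + \<i> * of_real 0))"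
      by (intro tendsto_intros X) (use nz in auto)
    then show "(\<lambda>n. g s / (of_real s - (z + \<i> * of_real (X n)))) \<longlonglongrightarrow> g s / (of_real s - z)"
      by simp
  qed
  fix n
  show "AE s in lborel. norm (g s / (of_real s - (z + \<i> * of_real (X n)))) \<le> 2 * norm (g s / (of_real s - z))"
  proof (rule AE_I2)
    fix s
    let ?d = "complex_of_real s - z"
    have "\<bar>Im z\<bar> \<le> norm ?d" using abs_Im_le_cmod[of ?d] by simp
    moreover have "norm (\<i> * complex_of_real (X n)) = \<bar>X n\<bar>" by (simp add: norm_mult)
    ultimately have "norm ?d / 2 \<le> norm (?d - \<i> * of_real (X n))"
      using norm_triangle_ineq2[of ?d "\<i> * of_real (X n)"] small[of n] by linarith
    then have "norm (g s) / norm (?d - \<i> * of_real (X n)) \<le> norm (g s) / (norm ?d / 2)"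
      using nz[of s] by (intro divide_left_mono) (auto intro!: mult_pos_pos)
    then show "norm (g s / (of_real s - (z + \<i> * of_real (X n)))) \<le> 2 * norm (g s / ?d)"
      by (simp add: norm_divide diff_diff_eq mult.commute)
  qed
qed (use g in measurable)

section \<open>Approximation by continuous functions and the Poisson kernel\<close>

lemma bounded_compact_support_square_integrable:
  fixes c :: "real \<Rightarrow> complex"
  assumes [measurable]: "c \<in> borel_measurable borel"
    and M: "\<And>x. norm (c x) \<le> M" and S: "\<And>x. \<bar>x\<bar> > R \<Longrightarrow> c x = 0"
  shows "square_integrable lborel c"
  unfolding square_integrable_def
proof
  show "integrable lborel (\<lambda>x. (norm (c x))\<^sup>2)"
  proof (rule Bochner_Integration.integrable_bound)
    show "integrable lborel (\<lambda>x. indicator {-R..R} x * M\<^sup>2)"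
      by (intro integrable_mult_left integrable_real_indicator) (auto simp: emeasure_lborel_Icc_eq)
    show "AE x in lborel. norm ((norm (c x))\<^sup>2) \<le> norm (indicator {-R..R} x * M\<^sup>2)"
      using M S by (auto simp: indicator_def abs_le_iff not_le intro!: power_mono)
  qed simp
qed simp

text \<open>
  After truncating in height and in space, \<open>measurable_on\<close> provides continuous functions that
  converge almost everywhere to the truncated function.  Clamping their values to the same height
  and multiplying by a continuous spatial cut-off supplies a dominating function.
\<close>
lemma continuous_dense_in_square_integrable:
  assumes k: "square_integrable lborel (k :: real \<Rightarrow> complex)" and e: "e > 0"
  obtains c M R where "continuous_on UNIV c" "\<And>x. norm (c x) \<le> M" "\<And>x. \<bar>x\<bar> > R \<Longrightarrow> c x = 0"
    "square_integrable lborel c" "(LINT x|lborel. (norm (k x - c x))\<^sup>2) < e"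
proof -
  note [measurable] = square_integrable_measurable[OF k]
  define kk where "kk n x = (if norm (k x) \<le> real n \<and> \<bar>x\<bar> \<le> real n then k x else 0)" for n :: nat and x
  have [measurable]: "kk n \<in> borel_measurable borel" for n
    unfolding kk_def by measurable
  have "(\<lambda>n. LINT x|lborel. (norm (k x - kk n x))\<^sup>2) \<longlonglongrightarrow> integral\<^sup>L lborel (\<lambda>x::real. 0::real)"
  proof (rule integral_dominated_convergence[where w = "\<lambda>x. (norm (k x))\<^sup>2"])
    show "AE x in lborel. (\<lambda>n. (norm (k x - kk n x))\<^sup>2) \<longlonglongrightarrow> 0"
    proof (intro AE_I2 tendsto_eventually)
      fix x
      obtain m where "max (norm (k x)) \<bar>x\<bar> \<le> real m" using real_arch_simple by blast
      then show "\<forall>\<^sub>F n in sequentially. (norm (k x - kk n x))\<^sup>2 = 0"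
        by (intro eventually_sequentiallyI[of m]) (auto simp: kk_def)
    qed
    show "integrable lborel (\<lambda>x. (norm (k x))\<^sup>2)" by (rule square_integrable_norm2[OF k])
  qed (auto simp: kk_def)
  then have "\<forall>\<^sub>F n in sequentially. (LINT x|lborel. (norm (k x - kk n x))\<^sup>2) < e / 4"
    using e by (intro order_tendstoD) auto
  then have "\<forall>\<^sub>F n in sequentially. (LINT x|lborel. (norm (k x - kk n x))\<^sup>2) < e / 4 \<and> n > 0"
    by (intro eventually_conj eventually_gt_at_top)
  then obtain n where n: "(LINT x|lborel. (norm (k x - kk n x))\<^sup>2) < e / 4" "n > 0"
    by (auto simp: eventually_sequentially)
  define N where "N = real n"
  have N: "N > 0" and bN: "norm (kk n x) \<le> N" "\<bar>x\<bar> > N \<Longrightarrow> kk n x = 0" for x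
    using n by (auto simp: N_def kk_def)
  have kk2: "square_integrable lborel (kk n)"
    by (rule bounded_compact_support_square_integrable[where M = N and R = N]) (use bN in auto)
  have "kk n \<in> borel_measurable lebesgue"
    by (intro measurable_completion) simp
  then have "kk n measurable_on UNIV"
    by (rule lebesgue_measurable_imp_measurable_on) auto
  then obtain Z G where Z: "negligible Z" and G: "\<And>j. continuous_on UNIV (G j)"
    and lim: "\<And>x. x \<notin> Z \<Longrightarrow> (\<lambda>j. G j x) \<longlonglongrightarrow> kk n x"
    unfolding measurable_on_def by auto
  have AEZ: "AE x in lborel. x \<notin> Z"
    using Z AE_not_in[of Z lebesgue] by (simp add: negligible_iff_null_sets AE_completion_iff)
  \<comment> \<open>the second factor is the radial projection of \<open>G j x\<close> to the disc of radius \<open>N\<close>\<close>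
  define c where "c j x = of_real (max 0 (min 1 (N + 1 - \<bar>x\<bar>))) *
    (G j x * of_real (N / max N (norm (G j x))))" for j x
  have cont: "continuous_on UNIV (c j)" for j
    unfolding c_def by (intro continuous_intros G) (use N in auto)
  then have [measurable]: "c j \<in> borel_measurable borel" for j
    by (simp add: borel_measurable_continuous_onI)
  have clamp: "norm (w * of_real (N / max N (norm w))) \<le> N" for w :: complex
    using N by (auto simp: norm_mult norm_divide max_def divide_simps)
  have cb: "norm (c j x) \<le> N" for j x
    using mult_mono[OF _ clamp[of "G j x"], of "\<bar>max 0 (min 1 (N + 1 - \<bar>x\<bar>))\<bar>" 1]
    by (simp add: c_def norm_mult del: of_real_divide)
  have cs: "c j x = 0" if "\<bar>x\<bar> > N + 1" for j x
    using that by (auto simp: c_def)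
  have c2: "square_integrable lborel (c j)" for j
    by (rule bounded_compact_support_square_integrable[where M = N and R = "N + 1"]) (use cb cs in auto)
  have "(\<lambda>j. LINT x|lborel. (norm (kk n x - c j x))\<^sup>2) \<longlonglongrightarrow> integral\<^sup>L lborel (\<lambda>x::real. 0::real)"
  proof (rule integral_dominated_convergence[where w = "\<lambda>x. indicator {-(N+1)..N+1} x * (2 * N)\<^sup>2"])
    show "integrable lborel (\<lambda>x. indicator {- (N + 1)..N + 1} x * (2 * N)\<^sup>2)"
      by (intro integrable_mult_left integrable_real_indicator) (auto simp: emeasure_lborel_Icc_eq)
    show "AE x in lborel. (\<lambda>j. (norm (kk n x - c j x))\<^sup>2) \<longlonglongrightarrow> 0"
      using AEZ
    proof eventually_elim
      case (elim x)
      have "(\<lambda>j. c j x) \<longlonglongrightarrow> of_real (max 0 (min 1 (N + 1 - \<bar>x\<bar>))) *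
          (kk n x * of_real (N / max N (norm (kk n x))))"
        unfolding c_def by (intro tendsto_intros lim elim) (use N in auto)
      moreover have "of_real (max 0 (min 1 (N + 1 - \<bar>x\<bar>))) * (kk n x * of_real (N / max N (norm (kk n x)))) = kk n x"
        using bN[of x] N by (cases "\<bar>x\<bar> > N") (auto simp: max_def min_def)
      ultimately have "(\<lambda>j. c j x) \<longlonglongrightarrow> kk n x" by metis
      then have "(\<lambda>j. (norm (kk n x - c j x))\<^sup>2) \<longlonglongrightarrow> (norm (kk n x - kk n x))\<^sup>2"
        by (intro tendsto_intros)
      then show ?case by simp
    qed
    fix j
    show "AE x in lborel. norm ((norm (kk n x - c j x))\<^sup>2) \<le> indicator {- (N + 1)..N + 1} x * (2 * N)\<^sup>2"
    proof (rule AE_I2)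
      fix x
      show "norm ((norm (kk n x - c j x))\<^sup>2) \<le> indicator {- (N + 1)..N + 1} x * (2 * N)\<^sup>2"
      proof (cases "\<bar>x\<bar> \<le> N + 1")
        case True
        have "norm (kk n x - c j x) \<le> 2 * N"
          using norm_triangle_ineq4[of "kk n x" "c j x"] cb[of j x] bN(1)[of x] by linarith
        from power_mono[OF this, of 2] show ?thesis
          using True by (auto simp: indicator_def abs_le_iff)
      next
        case False
        then show ?thesis using cs[of x j] bN(2)[of x] by (auto simp: indicator_def)
      qed
    qed
  qed auto
  then have "\<forall>\<^sub>F j in sequentially. (LINT x|lborel. (norm (kk n x - c j x))\<^sup>2) < e / 4"
    using e by (intro order_tendstoD) auto
  then obtain j where j: "(LINT x|lborel. (norm (kk n x - c j x))\<^sup>2) < e / 4"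
    by (auto simp: eventually_sequentially)
  have i1: "integrable lborel (\<lambda>x. (norm (k x - kk n x))\<^sup>2)"
    and i2: "integrable lborel (\<lambda>x. (norm (kk n x - c j x))\<^sup>2)"
    and i3: "integrable lborel (\<lambda>x. (norm (k x - c j x))\<^sup>2)"
    using square_integrable_diff k kk2 c2 square_integrable_norm2 by blast+
  have "(LINT x|lborel. (norm (k x - c j x))\<^sup>2)
      \<le> (LINT x|lborel. 2 * (norm (k x - kk n x))\<^sup>2 + 2 * (norm (kk n x - c j x))\<^sup>2)"
    using i1 i2 i3 norm_add_le_squares[of "k x - kk n x" "kk n x - c j x" for x]
    by (intro integral_mono) auto
  also have "\<dots> < e" using i1 i2 n j by simp
  finally show thesis using that[OF cont cb cs c2] by blast
qed

text \<open>
  Continuity of translations in \<open>L\<^sup>2\<close>, in weak form: by density \<open>k\<close> may be replaced by a continuous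
  function with compact support, with an error that the Cauchy-Schwarz inequality bounds uniformly
  in the translation.
\<close>
lemma correlation_tendsto:
  fixes g k :: "real \<Rightarrow> complex"
  assumes g: "square_integrable lborel g" and k: "square_integrable lborel k" and X: "X \<longlonglongrightarrow> 0"
  shows "(\<lambda>n. LINT s|lborel. g s * k (s + X n)) \<longlonglongrightarrow> (LINT s|lborel. g s * k s)"
proof (rule tendstoI)
  fix e :: real assume e: "e > 0"
  note [measurable] = square_integrable_measurable[OF k] square_integrable_measurable[OF g]
  have shift: "square_integrable lborel (\<lambda>s. f (s + t))"
    "(LINT s|lborel. (norm (f (s + t)))\<^sup>2) = (LINT s|lborel. (norm (f s))\<^sup>2)"
    if "square_integrable lborel f" for f :: "real \<Rightarrow> complex" and t
    using that lborel_integrable_real_affine[of "\<lambda>s. (norm (f s))\<^sup>2" 1 t]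
      lborel_integral_real_affine[of 1 "\<lambda>s. (norm (f s))\<^sup>2" t]
    by (auto simp: square_integrable_def add.commute)
  define G where "G = (LINT s|lborel. (norm (g s))\<^sup>2)"
  have G: "G \<ge> 0" unfolding G_def by simp
  obtain c M R where c: "continuous_on UNIV c" "\<And>x. norm (c x) \<le> M" "\<And>x. \<bar>x\<bar> > R \<Longrightarrow> c x = 0"
    "square_integrable lborel c" "(LINT x|lborel. (norm (k x - c x))\<^sup>2) < (e / 3)\<^sup>2 / (G + 1)"
    using continuous_dense_in_square_integrable[OF k, of "(e / 3)\<^sup>2 / (G + 1)"] e G by auto
  have [measurable]: "c \<in> borel_measurable borel"
    using c(1) by (simp add: borel_measurable_continuous_onI)
  define A where "A f t = (LINT s|lborel. g s * f (s + t))" for f :: "real \<Rightarrow> complex" and t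
  have close: "norm (A k t - A c t) < e / 3" for t
  proof -
    have "A k t - A c t = (LINT s|lborel. g s * (k (s + t) - c (s + t)))"
      unfolding A_def right_diff_distrib
      by (intro Bochner_Integration.integral_diff[symmetric] integrable_mult_square_integrable
          shift(1) g k c(4))
    then have "(norm (A k t - A c t))\<^sup>2 \<le> G * (LINT x|lborel. (norm (k x - c x))\<^sup>2)"
      using norm_integral_mult_le[OF g shift(1)[OF square_integrable_diff[OF k c(4)], of t]]
        shift(2)[OF square_integrable_diff[OF k c(4)], of t] by (simp add: G_def)
    also have "\<dots> \<le> G * ((e / 3)\<^sup>2 / (G + 1))"
      using c(5) G by (intro mult_left_mono) auto
    also have "\<dots> < (e / 3)\<^sup>2" using G e by (simp add: field_simps)
    finally show ?thesis using e by (intro power2_less_imp_less[of _ "e / 3"]) auto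
  qed
  have "(\<lambda>n. A c (X n)) \<longlonglongrightarrow> A c 0"
  proof -
    obtain B where B: "\<And>n. \<bar>X n\<bar> \<le> B"
      using convergent_imp_Bseq[of X] X by (auto simp: convergent_def Bseq_def)
    have M: "M \<ge> 0" using c(2)[of 0] norm_ge_zero order_trans by blast
    have m2: "square_integrable lborel (\<lambda>s. of_real (indicator {-(R+B)..R+B} s * M) :: complex)"
      by (rule bounded_compact_support_square_integrable[where M = M and R = "R + B"])
         (use M in \<open>auto simp: indicator_def\<close>)
    show ?thesis
      unfolding A_def
    proof (rule integral_dominated_convergence[where w = "\<lambda>s. norm (g s * of_real (indicator {-(R+B)..R+B} s * M))"])
      show "integrable lborel (\<lambda>s. norm (g s * of_real (indicator {-(R+B)..R+B} s * M)))"
        by (intro integrable_norm integrable_mult_square_integrable g m2)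
      show "AE s in lborel. (\<lambda>n. g s * c (s + X n)) \<longlonglongrightarrow> g s * c (s + 0)"
      proof (intro AE_I2 tendsto_intros)
        fix s
        have "isCont c (s + 0)" using c(1) by (simp add: continuous_on_eq_continuous_at)
        then show "(\<lambda>n. c (s + X n)) \<longlonglongrightarrow> c (s + 0)"
          by (rule isCont_tendsto_compose) (intro tendsto_intros X)
      qed
      show "AE s in lborel. norm (g s * c (s + X n)) \<le> norm (g s * of_real (indicator {-(R+B)..R+B} s * M))" for n
      proof (rule AE_I2)
        fix s
        have "norm (c (s + X n)) \<le> indicator {-(R+B)..R+B} s * M"
          using c(2)[of "s + X n"] c(3)[of "s + X n"] B[of n] by (auto simp: indicator_def)
        then show "norm (g s * c (s + X n)) \<le> norm (g s * of_real (indicator {-(R+B)..R+B} s * M))"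
          using M by (auto simp: norm_mult intro!: mult_left_mono)
      qed
    qed auto
  qed
  then have "\<forall>\<^sub>F n in sequentially. dist (A c (X n)) (A c 0) < e / 3"
    using e by (intro tendstoD) auto
  then show "\<forall>\<^sub>F n in sequentially. dist (LINT s|lborel. g s * k (s + X n)) (LINT s|lborel. g s * k s) < e"
  proof eventually_elim
    case (elim n)
    have "dist (A k (X n)) (A k 0) < e"
      using elim close[of "X n"] close[of 0]
        norm_triangle_ineq[of "A k (X n) - A c (X n)" "(A c (X n) - A c 0) - (A k 0 - A c 0)"]
        norm_triangle_ineq4[of "A c (X n) - A c 0" "A k 0 - A c 0"]
      by (simp add: dist_norm)
    then show ?case by (simp add: A_def)
  qed
qed

lemma integrable_lborel_pairI:
  fixes F :: "real \<Rightarrow> real \<Rightarrow> complex"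
  assumes "case_prod F \<in> borel_measurable (lborel \<Otimes>\<^sub>M lborel)"
    and "\<And>x. integrable lborel (F x)"
    and "\<And>x. (LINT y|lborel. norm (F x y)) \<le> B x" and "integrable lborel B"
  shows "integrable (lborel \<Otimes>\<^sub>M lborel) (case_prod F)"
proof (rule lborel_pair.Fubini_integrable)
  show "integrable lborel (\<lambda>x. LINT y|lborel. norm (case_prod F (x, y)))"
  proof (rule Bochner_Integration.integrable_bound[OF assms(4)])
    show "(\<lambda>x. LINT y|lborel. norm (case_prod F (x, y))) \<in> borel_measurable lborel"
      using assms(1) by measurable
    show "AE x in lborel. norm (LINT y|lborel. norm (case_prod F (x, y))) \<le> norm (B x)"
      using assms(3) by (auto intro: order_trans abs_ge_self)
  qed
qed (use assms in auto)

text \<open>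
  The inner integral is \<open>\<pi>\<close> times the Poisson integral of \<open>k\<close> at height \<open>X n\<close>, with the variable
  rescaled so that the kernel does not depend on the height.  After exchanging the integrals the
  limit falls on the correlation of \<open>g\<close> and \<open>k\<close>, which is bounded and continuous at \<open>0\<close>.
\<close>
lemma poisson_pairing_tendsto:
  fixes g k :: "real \<Rightarrow> complex"
  assumes g: "square_integrable lborel g" and k: "square_integrable lborel k" and X: "X \<longlonglongrightarrow> 0"
  shows "(\<lambda>n. LINT s|lborel. g s * (LINT y|lborel. k (s + X n * y) / (1 + y\<^sup>2)))
    \<longlonglongrightarrow> of_real pi * (LINT s|lborel. g s * k s)"
proof -
  note [measurable] = square_integrable_measurable[OF k] square_integrable_measurable[OF g]
  define A where "A t = (LINT s|lborel. g s * k (s + t))" for t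
  have [measurable]: "A \<in> borel_measurable borel" unfolding A_def by measurable
  have shift: "square_integrable lborel (\<lambda>s. k (s + t))"
    "(LINT s|lborel. (norm (k (s + t)))\<^sup>2) = (LINT s|lborel. (norm (k s))\<^sup>2)" for t
    using k lborel_integrable_real_affine[of "\<lambda>s. (norm (k s))\<^sup>2" 1 t]
      lborel_integral_real_affine[of 1 "\<lambda>s. (norm (k s))\<^sup>2" t]
    by (auto simp: square_integrable_def add.commute)
  define B where "B = ((LINT s|lborel. (norm (g s))\<^sup>2) + (LINT s|lborel. (norm (k s))\<^sup>2)) / 2"
  have AB1: "(LINT s|lborel. norm (g s * k (s + t))) \<le> B" for t
  proof -
    have "(LINT s|lborel. norm (g s * k (s + t)))
        \<le> (LINT s|lborel. ((norm (g s))\<^sup>2 + (norm (k (s + t)))\<^sup>2) / 2)"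
      using norm_mult_le_squares
      by (intro integral_mono integrable_norm integrable_mult_square_integrable g shift
          integrable_divide Bochner_Integration.integrable_add square_integrable_norm2)
    also have "\<dots> = B"
      by (simp add: B_def shift square_integrable_norm2[OF g] square_integrable_norm2[OF shift(1)])
    finally show ?thesis .
  qed
  then have AB: "norm (A t) \<le> B" for t
    unfolding A_def by (intro order_trans[OF integral_norm_bound])
  have pos: "1 + y\<^sup>2 > 0" for y :: real using sum_power2_gt_zero_iff[of 1 y] by simp
  have swap: "(LINT s|lborel. g s * (LINT y|lborel. k (s + t * y) / (1 + y\<^sup>2)))
      = (LINT y|lborel. A (t * y) / complex_of_real (1 + y\<^sup>2))" for t
  proof -
    define F where "F y s = g s * k (s + t * y) / of_real (1 + y\<^sup>2)" for y s
    have int: "integrable (lborel \<Otimes>\<^sub>M lborel) (case_prod F)"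
    proof (rule integrable_lborel_pairI[where B = "\<lambda>y. B * (1 / (1 + y\<^sup>2))"])
      show "case_prod F \<in> borel_measurable (lborel \<Otimes>\<^sub>M lborel)"
        unfolding F_def by measurable
      show "integrable lborel (F y)" for y
        unfolding F_def by (intro integrable_divide integrable_mult_square_integrable g shift)
      show "(LINT s|lborel. norm (F y s)) \<le> B * (1 / (1 + y\<^sup>2))" for y
        using divide_right_mono[OF AB1[of "t * y"], of "1 + y\<^sup>2"] pos[of y]
        by (simp add: F_def norm_divide del: of_real_add)
      show "integrable lborel (\<lambda>y. B * (1 / (1 + y\<^sup>2)))"
        by (intro integrable_mult_right has_integral_inverse_one_plus_square)
    qed
    have 1: "(LINT s|lborel. F y s) = A (t * y) / complex_of_real (1 + y\<^sup>2)" for y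
      unfolding F_def A_def integral_divide_zero by simp
    have 2: "(LINT y|lborel. F y s) = g s * (LINT y|lborel. k (s + t * y) / (1 + y\<^sup>2))" for s
      unfolding F_def times_divide_eq_right[symmetric] integral_mult_right_zero by simp
    have "(LINT s|lborel. (LINT y|lborel. F y s)) = (LINT y|lborel. (LINT s|lborel. F y s))"
      by (rule lborel_pair.Fubini_integral[OF int])
    then show ?thesis unfolding 1 2 .
  qed
  have "(\<lambda>n. LINT y|lborel. A (X n * y) / complex_of_real (1 + y\<^sup>2)) \<longlonglongrightarrow> (LINT y|lborel. A 0 / complex_of_real (1 + y\<^sup>2))"
  proof (rule integral_dominated_convergence[where w = "\<lambda>y. B * (1 / (1 + y\<^sup>2))"])
    show "integrable lborel (\<lambda>y. B * (1 / (1 + y\<^sup>2)))"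
      by (intro integrable_mult_right has_integral_inverse_one_plus_square)
    show "AE y in lborel. (\<lambda>n. A (X n * y) / complex_of_real (1 + y\<^sup>2)) \<longlonglongrightarrow> A 0 / complex_of_real (1 + y\<^sup>2)"
    proof (intro AE_I2 tendsto_intros)
      fix y :: real
      have "(\<lambda>n. X n * y) \<longlonglongrightarrow> 0" using tendsto_mult_right[OF X, of y] by simp
      from correlation_tendsto[OF g k this] show "(\<lambda>n. A (X n * y)) \<longlonglongrightarrow> A 0"
        by (simp add: A_def)
      show "complex_of_real (1 + y\<^sup>2) \<noteq> 0" using pos[of y] by (simp del: of_real_add)
    qed
    show "AE y in lborel. norm (A (X n * y) / complex_of_real (1 + y\<^sup>2)) \<le> B * (1 / (1 + y\<^sup>2))" for n
    proof (rule AE_I2)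
      fix y :: real
      show "norm (A (X n * y) / complex_of_real (1 + y\<^sup>2)) \<le> B * (1 / (1 + y\<^sup>2))"
        using divide_right_mono[OF AB[of "X n * y"], of "1 + y\<^sup>2"] pos[of y]
        by (simp add: norm_divide del: of_real_add)
    qed
  qed auto
  moreover have "(LINT y|lborel. A 0 / complex_of_real (1 + y\<^sup>2)) = of_real pi * A 0"
  proof -
    have "(LINT y|lborel. A 0 / complex_of_real (1 + y\<^sup>2)) = (LINT y|lborel. A 0 * of_real (1 / (1 + y\<^sup>2)))" by simp
    also have "\<dots> = A 0 * of_real (LINT y|lborel. 1 / (1 + y\<^sup>2))"
      by (subst integral_mult_right_zero, subst integral_complex_of_real) simp
    finally show ?thesis by (simp add: has_integral_inverse_one_plus_square(2))
  qed
  ultimately show ?thesis unfolding swap by (simp add: A_def)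
qed

section \<open>Products of boundary values of Hardy functions\<close>

text \<open>
  Bounding the product of \<open>g\<close> and the kernel by half the sum of their squares makes the inner
  integral bounded uniformly in \<open>x\<close>, because the \<open>L\<^sup>2\<close> norm of the kernel does not depend on \<open>x\<close>.
\<close>
lemma integrable_cauchy_pair:
  assumes k: "integrable lborel (k :: real \<Rightarrow> complex)" and g: "square_integrable lborel g" and d: "d \<noteq> 0"
  shows "integrable (lborel \<Otimes>\<^sub>M lborel) (\<lambda>(x, s). k x * (g s / (of_real s - Complex x d)))"
proof (rule integrable_lborel_pairI)
  note [measurable] = square_integrable_measurable[OF g] borel_measurable_integrable[OF k]
  define B where "B = ((LINT s|lborel. (norm (g s))\<^sup>2) + pi / \<bar>d\<bar>) / 2"
  have cont: "continuous_on UNIV (\<lambda>p::real \<times> real. 1 / (of_real (snd p) - Complex (fst p) d))"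
    unfolding complex_eq by (intro continuous_intros) (use d in \<open>auto simp: complex_eq_iff\<close>)
  have [measurable]: "(\<lambda>p::real \<times> real. 1 / (of_real (snd p) - Complex (fst p) d)) \<in> borel_measurable (lborel \<Otimes>\<^sub>M lborel)"
    using borel_measurable_continuous_onI[OF cont]
    by (simp add: lborel_prod)
  have "(\<lambda>p. k (fst p) * (g (snd p) * (1 / (of_real (snd p) - Complex (fst p) d)))) \<in> borel_measurable (lborel \<Otimes>\<^sub>M lborel)"
    by measurable
  then show "(\<lambda>(x, s). k x * (g s / (of_real s - Complex x d))) \<in> borel_measurable (lborel \<Otimes>\<^sub>M lborel)"
    by (simp add: case_prod_beta)
  show "integrable lborel (\<lambda>s. k x * (g s / (of_real s - Complex x d)))" for x
    using d by (intro integrable_mult_right integrable_divide_shift g) auto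
  show "(LINT s|lborel. norm (k x * (g s / (of_real s - Complex x d)))) \<le> norm (k x) * B" for x
  proof -
    have dx: "Im (Complex x d) \<noteq> 0" using d by simp
    have "(LINT s|lborel. norm (g s * (1 / (of_real s - Complex x d))))
        \<le> (LINT s|lborel. ((norm (g s))\<^sup>2 + (norm (1 / (of_real s - Complex x d)))\<^sup>2) / 2)"
      using norm_mult_le_squares
      by (intro integral_mono integrable_norm integrable_mult_square_integrable g
          square_integrable_cauchy_kernel dx
          integrable_divide Bochner_Integration.integrable_add square_integrable_norm2)
    also have "\<dots> = B"
      unfolding integral_divide_zero B_def
      by (subst Bochner_Integration.integral_add)
         (use square_integrable_norm2[OF g] integral_cauchy_kernel_square[OF dx] in auto)
    finally have "norm (k x) * (LINT s|lborel. norm (g s * (1 / (of_real s - Complex x d)))) \<le> norm (k x) * B"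
      by (intro mult_left_mono) auto
    moreover have "norm (k x * (g s / (of_real s - Complex x d)))
        = norm (k x) * norm (g s * (1 / (of_real s - Complex x d)))" for s
      by (simp add: norm_mult norm_divide)
    ultimately show ?thesis by simp
  qed
  show "integrable lborel (\<lambda>x. norm (k x) * B)"
    using k by (intro integrable_mult_left integrable_norm)
qed

text \<open>
  Put \<open>k x = f x / (x - z)\<close> and let \<open>J d\<close> be the double integral of \<open>g s k x / (s - x - \<i> d)\<close>.
  For \<open>d < 0\<close> the integral over \<open>s\<close> is a value of the Cauchy transform of \<open>g\<close> in the lower
  half-plane, so \<open>J d = 0\<close>.  For \<open>d > 0\<close> the identity
  \<open>1 / ((x - z) (p - x)) = (1 / (x - z) - 1 / (x - p)) / (p - z)\<close> with \<open>p = s - \<i> d\<close> in the lower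
  half-plane leaves \<open>J d = C f z \<cdot> C g (z + \<i> d)\<close>.  The difference \<open>J d - J (- d)\<close> has the Poisson kernel
  \<open>2 \<i> d / ((s - x)\<^sup>2 + d\<^sup>2)\<close> and tends to \<open>2 \<pi> \<i> \<integral> g k\<close> as \<open>d\<close> tends to \<open>0\<close>.
\<close>
theorem cauchy_transform_mult:
  assumes f: "square_integrable lborel f" and g: "square_integrable lborel g"
    and f0: "\<And>p. Im p < 0 \<Longrightarrow> cauchy_transform f p = 0"
    and g0: "\<And>p. Im p < 0 \<Longrightarrow> cauchy_transform g p = 0"
    and z: "Im z \<noteq> 0"
  shows "2 * pi * \<i> * cauchy_transform (\<lambda>x. f x * g x) z = cauchy_transform f z * cauchy_transform g z"
proof -
  note [measurable] = square_integrable_measurable[OF f] square_integrable_measurable[OF g]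
  define k where "k x = f x / (of_real x - z)" for x
  have k: "square_integrable lborel k" "integrable lborel k"
    unfolding k_def by (intro square_integrable_divide_shift integrable_divide_shift f z)+
  note [measurable] = square_integrable_measurable[OF k(1)]
  define J where "J d = (LINT s|lborel. g s * (LINT x|lborel. k x / (of_real s - Complex x d)))" for d
  have kernel_int: "integrable lborel (\<lambda>x. k x / (of_real s - Complex x d))" if "d \<noteq> 0" for s d
  proof -
    have "of_real s - Complex x d = - (of_real x - Complex s (- d))" for x
      by (simp add: complex_eq_iff)
    then have "k x / (of_real s - Complex x d) = - (k x / (of_real x - Complex s (- d)))" for x
      by (simp only: minus_divide_right)
    then show ?thesis
      using integrable_divide_shift[OF k(1), of "Complex s (- d)"] that by simp
  qed
  have J_int: "integrable lborel (\<lambda>s. g s * (LINT x|lborel. k x / (of_real s - Complex x d)))" if "d \<noteq> 0" for d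
  proof -
    have "(LINT x|lborel. k x * (g s / (of_real s - Complex x d))) = g s * (LINT x|lborel. k x / (of_real s - Complex x d))" for s
      by (subst integral_mult_right_zero[symmetric]) (simp add: mult.commute)
    then show ?thesis
      using lborel_pair.integrable_snd[OF integrable_cauchy_pair[OF k(2) g that]] by simp
  qed
  have J_lower: "J d = 0" if "d < 0" for d
  proof -
    have "J d = (LINT s|lborel. (LINT x|lborel. k x * (g s / (of_real s - Complex x d))))"
      unfolding J_def by (subst integral_mult_right_zero[symmetric]) (simp add: mult.commute)
    also have "\<dots> = (LINT x|lborel. (LINT s|lborel. k x * (g s / (of_real s - Complex x d))))"
      using integrable_cauchy_pair[OF k(2) g] that by (intro lborel_pair.Fubini_integral) auto
    also have "\<dots> = (LINT x|lborel. k x * cauchy_transform g (Complex x d))"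
      unfolding integral_mult_right_zero cauchy_transform_def ..
    also have "\<dots> = 0" using g0 that by simp
    finally show ?thesis .
  qed
  have J_upper: "J d = cauchy_transform f z * cauchy_transform g (z + \<i> * d)" if "d > 0" "Im z + d \<noteq> 0" for d
  proof -
    have "(LINT x|lborel. k x / (of_real s - Complex x d)) = cauchy_transform f z / (of_real s - (z + \<i> * d))" for s
    proof -
      define p where "p = Complex s (- d)"
      have p: "Im p \<noteq> 0" "cauchy_transform f p = 0" "p \<noteq> z" "of_real s - (z + \<i> * d) = p - z"
        using that f0[of p] by (auto simp: p_def complex_eq_iff)
      have "k x / (of_real s - Complex x d) = (f x / (of_real x - z) - f x / (of_real x - p)) / (p - z)" for x
      proof -
        have e: "of_real s - Complex x d = p - of_real x" by (simp add: p_def complex_eq_iff)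
        have "of_real x - z \<noteq> 0" "of_real x - p \<noteq> 0" "p - of_real x \<noteq> 0" "p - z \<noteq> 0"
          using real_minus_complex_nonzero[OF z, of x] real_minus_complex_nonzero[OF p(1), of x] p(3) by auto
        then show ?thesis unfolding k_def e by (simp add: divide_simps) (simp add: algebra_simps)
      qed
      then have "(LINT x|lborel. k x / (of_real s - Complex x d)) = (cauchy_transform f z - cauchy_transform f p) / (p - z)"
        using integrable_divide_shift[OF f z] integrable_divide_shift[OF f p(1)]
        by (simp add: cauchy_transform_def)
      then show ?thesis by (simp add: p)
    qed
    then have "J d = (LINT s|lborel. cauchy_transform f z * (g s / (of_real s - (z + \<i> * d))))"
      unfolding J_def by (simp add: mult.commute)
    also have "\<dots> = cauchy_transform f z * cauchy_transform g (z + \<i> * d)"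
      unfolding integral_mult_right_zero cauchy_transform_def[of g] ..
    finally show ?thesis .
  qed
  have J_diff: "J d - J (- d) = 2 * \<i> * (LINT s|lborel. g s * (LINT y|lborel. k (s + d * y) / (1 + y\<^sup>2)))"
    if "d > 0" for d
  proof -
    have "(LINT x|lborel. k x / (of_real s - Complex x d)) - (LINT x|lborel. k x / (of_real s - Complex x (- d)))
        = 2 * \<i> * (LINT y|lborel. k (s + d * y) / (1 + y\<^sup>2))" for s
    proof -
      define q where "q x = k x / (of_real s - Complex x d) - k x / (of_real s - Complex x (- d))" for x
      have q: "d *\<^sub>R q (s + d * y) = 2 * \<i> * (k (s + d * y) / complex_of_real (1 + y\<^sup>2))" for y
      proof -
        have 1: "complex_of_real s - Complex (s + d * y) d = - of_real d * (of_real y + \<i>)"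
          and 2: "complex_of_real s - Complex (s + d * y) (- d) = - of_real d * (of_real y - \<i>)"
          by (auto simp: complex_eq_iff)
        have 3: "complex_of_real (1 + y\<^sup>2) = (of_real y + \<i>) * (of_real y - \<i>)"
          by (simp add: algebra_simps power2_eq_square)
        have nz: "complex_of_real y + \<i> \<noteq> 0" "complex_of_real y - \<i> \<noteq> 0" "complex_of_real d \<noteq> 0"
          using that by (auto simp: complex_eq_iff)
        show ?thesis unfolding q_def 1 2 3 scaleR_conv_of_real using nz
          by (simp add: divide_simps) (simp add: algebra_simps)
      qed
      have "(LINT x|lborel. k x / (of_real s - Complex x d)) - (LINT x|lborel. k x / (of_real s - Complex x (- d)))
          = (LINT x|lborel. q x)"
        unfolding q_def using that by (intro Bochner_Integration.integral_diff[symmetric] kernel_int) auto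
      also have "\<dots> = (LINT y|lborel. d *\<^sub>R q (s + d * y))"
        using that by (subst lborel_integral_real_affine[of d q s]) auto
      also have "\<dots> = 2 * \<i> * (LINT y|lborel. k (s + d * y) / (1 + y\<^sup>2))"
        unfolding q integral_mult_right_zero ..
      finally show ?thesis .
    qed
    note inner = this
    have "J d - J (- d) = (LINT s|lborel. g s * (LINT x|lborel. k x / (of_real s - Complex x d))
        - g s * (LINT x|lborel. k x / (of_real s - Complex x (- d))))"
      unfolding J_def using that by (intro Bochner_Integration.integral_diff[symmetric] J_int) auto
    also have "\<dots> = (LINT s|lborel. 2 * \<i> * (g s * (LINT y|lborel. k (s + d * y) / (1 + y\<^sup>2))))"
      unfolding right_diff_distrib[symmetric] inner by (simp add: mult_ac)
    also have "\<dots> = 2 * \<i> * (LINT s|lborel. g s * (LINT y|lborel. k (s + d * y) / (1 + y\<^sup>2)))"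
      unfolding integral_mult_right_zero ..
    finally show ?thesis .
  qed
  \<comment> \<open>heights small enough to keep \<open>z + \<i> X n\<close> away from the real line\<close>
  define X where "X n = \<bar>Im z\<bar> / (2 * real (Suc n))" for n
  have X: "X \<longlonglongrightarrow> 0" unfolding X_def
    using tendsto_mult_right[OF LIMSEQ_inverse_real_of_nat, of "\<bar>Im z\<bar> / 2"]
    by (simp add: field_simps)
  have X_pos: "X n > 0" and X_le: "X n \<le> \<bar>Im z\<bar> / 2" for n
    using z by (auto simp: X_def field_simps)
  have X_nz: "Im z + X n \<noteq> 0" for n
    using X_pos[of n] X_le[of n] by linarith
  have J_eq: "cauchy_transform f z * cauchy_transform g (z + \<i> * X n)
     = 2 * \<i> * (LINT s|lborel. g s * (LINT y|lborel. k (s + X n * y) / (1 + y\<^sup>2)))" for n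
    using J_diff[OF X_pos[of n]] J_upper[OF X_pos[of n] X_nz] J_lower[of "- X n"] X_pos[of n] by simp
  have "(\<lambda>n. cauchy_transform f z * cauchy_transform g (z + \<i> * X n))
      \<longlonglongrightarrow> cauchy_transform f z * cauchy_transform g z"
    using X_pos X_le by (intro tendsto_intros cauchy_transform_tendsto g z X) (simp add: abs_of_pos)
  moreover have "(\<lambda>n. 2 * \<i> * (LINT s|lborel. g s * (LINT y|lborel. k (s + X n * y) / (1 + y\<^sup>2))))
      \<longlonglongrightarrow> 2 * \<i> * (of_real pi * (LINT s|lborel. g s * k s))"
    by (intro tendsto_intros poisson_pairing_tendsto g k X)
  ultimately have "cauchy_transform f z * cauchy_transform g z = 2 * \<i> * (of_real pi * (LINT s|lborel. g s * k s))"
    unfolding J_eq by (rule LIMSEQ_unique)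
  moreover have "(LINT s|lborel. g s * k s) = cauchy_transform (\<lambda>x. f x * g x) z"
    unfolding cauchy_transform_def k_def by (simp add: mult.commute)
  ultimately show ?thesis by (simp add: mult_ac)
qed

section \<open>Smooth functions with compact support\<close>

text \<open>
  The powers of \<open>y\<close> in the denominator make this family of flat functions closed under
  differentiation up to linear combinations.
\<close>
definition flat :: "nat \<Rightarrow> real \<Rightarrow> real" where
  "flat m y = (if y > 0 then exp (- 1 / y) / y ^ m else 0)"

lemma DERIV_flat: "DERIV (flat m) y :> flat (m + 2) y - real m * flat (m + 1) y"
proof -
  consider "y > 0" | "y < 0" | "y = 0" by linarith
  then show ?thesis
  proof cases
    case 1
    have "DERIV (\<lambda>y. exp (- 1 / y) / y ^ m) y :>
        ((exp (- 1 / y) * (1 / y\<^sup>2)) * y ^ m - exp (- 1 / y) * (real m * y ^ (m - 1))) / (y ^ m * y ^ m)"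
      using 1 by (auto intro!: derivative_eq_intros simp: power2_eq_square)
    also have "((exp (- 1 / y) * (1 / y\<^sup>2)) * y ^ m - exp (- 1 / y) * (real m * y ^ (m - 1))) / (y ^ m * y ^ m)
        = flat (m + 2) y - real m * flat (m + 1) y"
      using 1 by (cases m) (simp_all add: flat_def field_simps power2_eq_square)
    finally show ?thesis
      by (rule DERIV_cong_ev[THEN iffD1, rotated -1])
         (use 1 in \<open>auto simp: flat_def intro!: eventually_mono[OF eventually_gt_at_top] eventually_nhds_in_open[of "{0<..}", THEN eventually_mono]\<close>)
  next
    case 2
    have "DERIV (\<lambda>_. 0) y :> flat (m + 2) y - real m * flat (m + 1) y"
      using 2 by (simp add: flat_def)
    then show ?thesis
      by (rule DERIV_cong_ev[THEN iffD1, rotated -1])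
         (use 2 in \<open>auto simp: flat_def intro!: eventually_nhds_in_open[of "{..<0}", THEN eventually_mono]\<close>)
  next
    case 3
    have "((\<lambda>h. flat m h / h) \<longlongrightarrow> 0) (at 0)"
    proof (rule filterlim_split_at)
      show "((\<lambda>h. flat m h / h) \<longlongrightarrow> 0) (at_left 0)"
        by (rule tendsto_eventually)
           (auto simp: flat_def eventually_at_left[of "-1"] intro!: exI[of _ "-1"])
      have "((\<lambda>h::real. inverse h ^ (m + 1) / exp (inverse h)) \<longlongrightarrow> 0) (at_right 0)"
        by (rule filterlim_compose[OF tendsto_power_div_exp_0 filterlim_inverse_at_top_right])
      then show "((\<lambda>h. flat m h / h) \<longlongrightarrow> 0) (at_right 0)"
        by (rule Lim_transform_eventually)
           (auto simp: flat_def eventually_at_right[of _ 1] exp_minus divide_simps intro!: exI[of _ 1])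
    qed
    then show ?thesis unfolding 3 has_field_derivative_iff by (simp add: flat_def)
  qed
qed

lemma flat_0_bounds: "0 \<le> flat 0 y" "flat 0 y \<le> 1"
  by (auto simp: flat_def)

lemma flat_0_tendsto_1: "filterlim f at_top F \<Longrightarrow> ((\<lambda>n. flat 0 (f n)) \<longlongrightarrow> 1) F"
proof -
  assume f: "filterlim f at_top F"
  have "((\<lambda>n. exp (- inverse (f n))) \<longlongrightarrow> exp (- 0)) F"
    by (intro tendsto_intros tendsto_inverse_0_at_top f)
  then have "((\<lambda>n. exp (- inverse (f n))) \<longlongrightarrow> 1) F" by simp
  moreover have "\<forall>\<^sub>F n in F. exp (- inverse (f n)) = flat 0 (f n)"
    using filterlim_at_top_dense[THEN iffD1, OF f, rule_format, of 0]
    by eventually_elim (simp add: flat_def inverse_eq_divide)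
  ultimately show ?thesis by (rule Lim_transform_eventually)
qed

text \<open>
  A supply of smooth functions that contains every test function used below.  Each generator has
  its derivative in the class, so all members have derivatives of every order by induction.
\<close>
inductive smooth_class :: "(real \<Rightarrow> real) \<Rightarrow> bool" where
  const: "smooth_class (\<lambda>_. c)"
| ident: "smooth_class (\<lambda>x. x)"
| flat: "smooth_class (\<lambda>x. flat m (a * x + b))"
| kernel: "t \<noteq> 0 \<Longrightarrow> smooth_class (\<lambda>x. 1 / ((x - a)\<^sup>2 + t\<^sup>2))"
| add: "smooth_class f \<Longrightarrow> smooth_class g \<Longrightarrow> smooth_class (\<lambda>x. f x + g x)"
| mult: "smooth_class f \<Longrightarrow> smooth_class g \<Longrightarrow> smooth_class (\<lambda>x. f x * g x)"

lemma smooth_class_derivative: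
  assumes "smooth_class f"
  obtains f' where "smooth_class f'" "\<And>x. DERIV f x :> f' x"
proof -
  from assms have "\<exists>f'. smooth_class f' \<and> (\<forall>x. DERIV f x :> f' x)"
  proof induction
    case (const c)
    show ?case by (rule exI[of _ "\<lambda>_. 0"]) (auto intro: smooth_class.const)
  next
    case ident
    show ?case by (rule exI[of _ "\<lambda>_. 1"]) (auto intro: smooth_class.const)
  next
    case (flat m a b)
    let ?f = "\<lambda>x. a * (flat (m + 2) (a * x + b) + (- real m) * flat (m + 1) (a * x + b))"
    have "smooth_class ?f" by (intro smooth_class.intros)
    moreover have "DERIV (\<lambda>x. flat m (a * x + b)) x :> ?f x" for x
    proof -
      have "DERIV (\<lambda>x. a * x + b) x :> a" by (auto intro!: derivative_eq_intros)
      from DERIV_chain2[OF DERIV_flat this, of m] show ?thesis by (simp add: algebra_simps)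
    qed
    ultimately show ?case by blast
  next
    case (kernel t a)
    let ?f = "\<lambda>x. - 2 * (x + - a) * ((1 / ((x - a)\<^sup>2 + t\<^sup>2)) * (1 / ((x - a)\<^sup>2 + t\<^sup>2)))"
    have "smooth_class ?f" using kernel by (intro smooth_class.intros)
    moreover have "DERIV (\<lambda>x. 1 / ((x - a)\<^sup>2 + t\<^sup>2)) x :> ?f x" for x
    proof -
      have "(x - a)\<^sup>2 + t\<^sup>2 \<noteq> 0" using kernel by (simp add: sum_power2_eq_zero_iff)
      then show ?thesis by (auto intro!: derivative_eq_intros simp: power2_eq_square)
    qed
    ultimately show ?case by blast
  next
    case (add f g)
    then obtain f' g' where "smooth_class f'" "\<forall>x. DERIV f x :> f' x" "smooth_class g'" "\<forall>x. DERIV g x :> g' x"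
      by blast
    then show ?case
      by (intro exI[of _ "\<lambda>x. f' x + g' x"]) (auto intro!: smooth_class.add derivative_intros)
  next
    case (mult f g)
    then obtain f' g' where *: "smooth_class f'" "\<forall>x. DERIV f x :> f' x" "smooth_class g'" "\<forall>x. DERIV g x :> g' x"
      by blast
    have "smooth_class (\<lambda>x. f' x * g x + g' x * f x)"
      using * mult by (intro smooth_class.intros)
    with * show ?case
      by (intro exI[of _ "\<lambda>x. f' x * g x + g' x * f x"]) (auto intro!: DERIV_mult)
  qed
  then show thesis using that by blast
qed

lemma smooth_class_higher_deriv: "smooth_class f \<Longrightarrow> smooth_class ((deriv ^^ k) f)"
proof (induction k)
  case (Suc k)
  then obtain f' where "smooth_class f'" "\<And>x. DERIV ((deriv ^^ k) f) x :> f' x"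
    using smooth_class_derivative by blast
  moreover from this have "deriv ((deriv ^^ k) f) = f'" by (auto intro: DERIV_imp_deriv)
  ultimately show ?case by simp
qed simp

lemma smooth_class_DERIV: "smooth_class f \<Longrightarrow> DERIV f x :> deriv f x"
  by (metis DERIV_imp_deriv smooth_class_derivative)

lemma smooth_class_deriv: "smooth_class f \<Longrightarrow> smooth_class (deriv f)"
  using smooth_class_higher_deriv[of f 1] by simp

lemma smooth_class_isCont: "smooth_class f \<Longrightarrow> isCont f x"
  using smooth_class_DERIV DERIV_isCont by blast

lemma smooth_class_measurable: "smooth_class f \<Longrightarrow> f \<in> borel_measurable borel"
  by (intro borel_measurable_continuous_onI continuous_at_imp_continuous_on ballI smooth_class_isCont)

lemma test_functionI:
  assumes "smooth_class f" and supp: "\<And>x. f x \<noteq> 0 \<Longrightarrow> \<bar>x\<bar> \<le> R"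
  shows "test_function f"
  unfolding test_function_def
proof (intro conjI allI)
  show "(deriv ^^ k) f field_differentiable at x" for k x
    using smooth_class_DERIV[OF smooth_class_higher_deriv[OF assms(1)]] field_differentiable_def by blast
  have "bounded {x. f x \<noteq> 0}" using supp by (auto simp: bounded_iff)
  then show "compact (closure {x. f x \<noteq> 0})" by simp
qed

text \<open>
  A bump on the interval from \<open>a\<close> to \<open>b\<close> whose steepness \<open>n\<close> is a parameter: since \<open>flat 0\<close> tends to
  \<open>1\<close> at infinity, the bumps converge to the indicator of the interval as \<open>n\<close> grows.  The two
  arguments are spelled as affine functions of \<open>x\<close> in the form required by \<open>smooth_class\<close>.
\<close>
definition bump :: "real \<Rightarrow> real \<Rightarrow> real \<Rightarrow> real \<Rightarrow> real" where
  "bump n a b x = flat 0 (n * x + (- n * a)) * flat 0 ((- n) * x + n * b)"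

lemma smooth_class_bump: "smooth_class (bump n a b)"
  unfolding bump_def[abs_def] by (intro smooth_class.intros)

lemma bump_bounds: "0 \<le> bump n a b x" "bump n a b x \<le> 1"
  using flat_0_bounds mult_mono[of "flat 0 _" 1 "flat 0 _" 1] by (auto simp: bump_def)

lemma bump_outside: "n > 0 \<Longrightarrow> \<not> (a < x \<and> x < b) \<Longrightarrow> bump n a b x = 0"
  by (auto simp: bump_def flat_def algebra_simps mult_le_cancel_left)

lemma test_function_bump: "n > 0 \<Longrightarrow> test_function (bump n a b)"
proof (rule test_functionI[OF smooth_class_bump])
  assume "n > 0"
  fix x assume "bump n a b x \<noteq> 0"
  then have "a < x \<and> x < b" using bump_outside[of n a x b] \<open>n > 0\<close> by blast
  then show "\<bar>x\<bar> \<le> max \<bar>a\<bar> \<bar>b\<bar>" by linarith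
qed

lemma bump_tendsto_indicator:
  "(\<lambda>n. bump (real (Suc n)) a b x) \<longlonglongrightarrow> indicator {a<..<b} x"
proof (cases "a < x \<and> x < b")
  case True
  have 1: "filterlim (\<lambda>n. real (Suc n) * c) at_top sequentially" if "c > 0" for c
    using filterlim_tendsto_pos_mult_at_top[OF tendsto_const that]
      filterlim_compose[OF filterlim_real_sequentially filterlim_Suc]
    by (simp add: mult.commute)
  have "(\<lambda>n. flat 0 (real (Suc n) * (x - a)) * flat 0 (real (Suc n) * (b - x))) \<longlonglongrightarrow> 1 * 1"
    using True by (intro tendsto_mult flat_0_tendsto_1 1) auto
  then show ?thesis using True by (simp add: bump_def algebra_simps)
next
  case False
  then have "bump (real (Suc n)) a b x = 0" for n by (intro bump_outside) auto
  then show ?thesis using False by auto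
qed

section \<open>Weak derivatives\<close>

lemma sigma_finite_lebesgue: "sigma_finite_measure (lebesgue :: real measure)"
proof
  obtain A :: "real set set" where "countable A" "A \<subseteq> sets lborel" "\<Union> A = space lborel"
    "\<forall>a\<in>A. emeasure lborel a \<noteq> \<infinity>"
    using lborel.sigma_finite_countable by auto
  then show "\<exists>A::real set set. countable A \<and> A \<subseteq> sets lebesgue \<and> \<Union> A = space lebesgue
      \<and> (\<forall>a\<in>A. emeasure lebesgue a \<noteq> \<infinity>)"
    by (intro exI[of _ A]) auto
qed

text \<open>
  On a bounded interval the sets over which \<open>d\<close> has vanishing integral form a Dynkin system that
  contains the half-lines, hence all Borel sets, and then all Lebesgue sets.
\<close>
lemma AE_zero_if_interval_integrals_zero:
  fixes d :: "real \<Rightarrow> 'a::euclidean_space"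
  assumes int: "\<And>a b. set_integrable lebesgue {a<..<b} d"
    and zero: "\<And>a b. (LINT x:{a<..<b}|lebesgue. d x) = 0"
  shows "AE x in lebesgue. d x = 0"
proof -
  have "AE x in lebesgue. indicator {- real n<..<real n} x *\<^sub>R d x = 0" for n
  proof (rule sigma_finite_measure.density_zero[OF sigma_finite_lebesgue])
    define D where "D x = indicator {- real n<..<real n} x *\<^sub>R d x" for x
    have D: "integrable lebesgue D"
      using int unfolding D_def[abs_def] set_integrable_def by blast
    then show "integrable lebesgue (\<lambda>x. indicator {- real n<..<real n} x *\<^sub>R d x)"
      by (simp add: D_def[abs_def])
    have D_ind: "set_integrable lebesgue A D" if "A \<in> sets lebesgue" for A
      unfolding set_integrable_def using integrable_mult_indicator[OF that D] .
    have total: "integral\<^sup>L lebesgue D = 0"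
      using zero unfolding D_def[abs_def] set_lebesgue_integral_def by blast
    have borel: "set_lebesgue_integral lebesgue A D = 0" if "A \<in> sets borel" for A
    proof -
      have "Int_stable (range (greaterThan :: real \<Rightarrow> real set))"
        by (auto simp: Int_stable_def lessThan_Int_lessThan)
      moreover have "range (greaterThan :: real \<Rightarrow> real set) \<subseteq> Pow UNIV" by simp
      moreover have "A \<in> sigma_sets UNIV (range (greaterThan :: real \<Rightarrow> real set))"
        using that unfolding borel_Ioi by simp
      ultimately show ?thesis
      proof (induction rule: sigma_sets_induct_disjoint[consumes 3])
        case (basic A)
        then obtain a where A: "A = {a<..}" by auto
        have "indicator A x *\<^sub>R D x = indicator {max a (- real n)<..<real n} x *\<^sub>R d x" for x
          by (auto simp: A D_def indicator_def)
        then show ?case using zero by (simp add: set_lebesgue_integral_def)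
      next
        case (compl A)
        then have A: "A \<in> sets lebesgue" by (simp add: borel_Ioi)
        have "indicator (UNIV - A) x *\<^sub>R D x = D x - indicator A x *\<^sub>R D x" for x
          by (auto simp: indicator_def)
        then show ?case
          using compl D D_ind[OF A] total by (simp add: set_lebesgue_integral_def set_integrable_def)
      next
        case (union A)
        have A: "A i \<in> sets lebesgue" for i
        proof -
          have "A i \<in> sets borel" using union(2) by (auto simp: borel_Ioi)
          then show ?thesis by simp
        qed
        show ?case
        proof (subst lebesgue_integral_countable_add)
          show "set_integrable lebesgue (\<Union>i. A i) D" using A by (intro D_ind) auto
        qed (use A union in \<open>auto simp: disjoint_family_on_def\<close>)
      next
        case empty
        show ?case by (simp add: set_lebesgue_integral_def)
      qed
    qed
    fix A :: "real set" assume A: "A \<in> sets lebesgue"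
    then obtain S N N' where "A = S \<union> N" "S \<in> sets lborel" "N \<subseteq> N'" "N' \<in> null_sets lborel"
      by (elim sets_completionE) 
    then have "AE x in lebesgue. x \<in> A \<longleftrightarrow> x \<in> S"
      using AE_not_in[of N' lborel] by (auto intro!: AE_completion elim!: eventually_mono)
    then have "set_lebesgue_integral lebesgue A D = set_lebesgue_integral lebesgue S D"
      unfolding set_lebesgue_integral_def
    proof (intro integral_cong_AE)
      show "(\<lambda>x. indicat_real A x *\<^sub>R D x) \<in> borel_measurable lebesgue"
        "(\<lambda>x. indicat_real S x *\<^sub>R D x) \<in> borel_measurable lebesgue"
        using D_ind[of A] D_ind[of S] A \<open>S \<in> sets lborel\<close>
        unfolding set_integrable_def by (auto intro: borel_measurable_integrable)
    qed (auto elim!: eventually_mono simp: indicator_def)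
    then show "(LINT x:A|lebesgue. indicator {- real n<..<real n} x *\<^sub>R d x) = 0"
      using borel[of S] \<open>S \<in> sets lborel\<close> by (simp add: D_def[abs_def])
  qed
  then have "AE x in lebesgue. \<forall>n. indicator {- real n<..<real n} x *\<^sub>R d x = 0"
    unfolding AE_all_countable by blast
  then show ?thesis
  proof eventually_elim
    case (elim x)
    obtain n where "\<bar>x\<bar> < real n" using reals_Archimedean2 by blast
    then show ?case using elim[rule_format, of n] by (auto simp: indicator_def)
  qed
qed

lemma locally_integrable_interval:
  assumes "locally_integrable f"
  shows "set_integrable lebesgue {a<..<b} f"
proof (rule set_integrable_subset)
  show "set_integrable lebesgue {a..b} f" using assms by (simp add: locally_integrable_def)
  show "{a<..<b} \<in> sets lebesgue" by simp
  show "{a<..<b} \<subseteq> {a..b}" by (rule subsetI) simp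
qed

lemma locally_integrable_measurable:
  assumes "locally_integrable f"
  shows "f \<in> borel_measurable lebesgue"
proof (rule borel_measurable_LIMSEQ_metric)
  show "(\<lambda>x. indicator {- real n..real n} x *\<^sub>R f x) \<in> borel_measurable lebesgue" for n
  proof -
    have "set_integrable lebesgue {- real n..real n} f"
      using assms by (simp add: locally_integrable_def)
    then show ?thesis unfolding set_integrable_def by (rule borel_measurable_integrable)
  qed
  fix x
  obtain m where "\<bar>x\<bar> < real m" using reals_Archimedean2 by blast
  then show "(\<lambda>n. indicator {- real n..real n} x *\<^sub>R f x) \<longlonglongrightarrow> f x"
    by (intro tendsto_eventually eventually_sequentiallyI[of m]) (auto simp: indicator_def)
qed

lemma bump_integral_tendsto:
  assumes f: "locally_integrable f"
  shows "(\<lambda>n. LINT x|lebesgue. bump (real (Suc n)) a b x *\<^sub>R f x) \<longlonglongrightarrow> (LINT x:{a<..<b}|lebesgue. f x)"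
  unfolding set_lebesgue_integral_def
proof (rule integral_dominated_convergence[where w = "\<lambda>x. norm (indicator {a<..<b} x *\<^sub>R f x)"])
  note [measurable] = locally_integrable_measurable[OF f]
  have bm: "bump r a b \<in> borel_measurable lebesgue" for r
    by (intro measurable_completion) (simp add: smooth_class_measurable smooth_class_bump)
  show "integrable lebesgue (\<lambda>x. norm (indicator {a<..<b} x *\<^sub>R f x))"
    using locally_integrable_interval[OF f] unfolding set_integrable_def by (rule integrable_norm)
  show "AE x in lebesgue. (\<lambda>n. bump (real (Suc n)) a b x *\<^sub>R f x) \<longlonglongrightarrow> indicator {a<..<b} x *\<^sub>R f x"
    by (intro AE_I2 tendsto_scaleR tendsto_const bump_tendsto_indicator)
  show "AE x in lebesgue. norm (bump (real (Suc n)) a b x *\<^sub>R f x) \<le> norm (indicator {a<..<b} x *\<^sub>R f x)" for n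
  proof (rule AE_I2)
    fix x
    show "norm (bump (real (Suc n)) a b x *\<^sub>R f x) \<le> norm (indicator {a<..<b} x *\<^sub>R f x)"
    proof (cases "a < x \<and> x < b")
      case True
      have "\<bar>bump (real (Suc n)) a b x\<bar> \<le> 1"
        using bump_bounds[of "real (Suc n)" a b x] by simp
      then have "\<bar>bump (real (Suc n)) a b x\<bar> * norm (f x) \<le> 1 * norm (f x)"
        by (intro mult_right_mono) auto
      then show ?thesis using True by simp
    next
      case False
      then have "bump (real (Suc n)) a b x = 0" by (intro bump_outside) auto
      then show ?thesis by simp
    qed
  qed
  show "(\<lambda>x. bump (real (Suc n)) a b x *\<^sub>R f x) \<in> borel_measurable lebesgue" for n
    by (intro borel_measurable_scaleR bm locally_integrable_measurable f)
  show "(\<lambda>x. indicat_real {a<..<b} x *\<^sub>R f x) \<in> borel_measurable lebesgue"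
    using locally_integrable_interval[OF f] unfolding set_integrable_def
    by (rule borel_measurable_integrable)
qed

text \<open>Testing with bumps that converge to the indicator of an interval shows that the two derivatives have equal integrals over it.\<close>
lemma weak_derivative_unique:
  assumes v: "has_weak_derivative u v" and v': "has_weak_derivative u v'"
  shows "AE x in lebesgue. v x = v' x"
proof -
  have loc: "locally_integrable v" "locally_integrable v'"
    using v v' by (auto simp: has_weak_derivative_def)
  have "(LINT x:{a<..<b}|lebesgue. v x) = (LINT x:{a<..<b}|lebesgue. v' x)" for a b
  proof -
    have eq: "(LINT x|lebesgue. bump (real (Suc n)) a b x *\<^sub>R v x) = (LINT x|lebesgue. bump (real (Suc n)) a b x *\<^sub>R v' x)" for n
    proof -
      have "test_function (bump (real (Suc n)) a b)" by (intro test_function_bump) simp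
      then have "- (LINT x|lebesgue. bump (real (Suc n)) a b x *\<^sub>R v x)
          = - (LINT x|lebesgue. bump (real (Suc n)) a b x *\<^sub>R v' x)"
        using v v' unfolding has_weak_derivative_def by metis
      then show ?thesis by simp
    qed
    show ?thesis
      by (rule LIMSEQ_unique[OF bump_integral_tendsto[OF loc(1), of a b, unfolded eq]
            bump_integral_tendsto[OF loc(2), of a b]])
  qed
  then have "AE x in lebesgue. v x - v' x = 0"
    using set_integral_diff[OF locally_integrable_interval[OF loc(1)] locally_integrable_interval[OF loc(2)]]
    by (intro AE_zero_if_interval_integrals_zero) simp_all
  then show ?thesis by simp
qed

text \<open>This bounds the derivative of \<open>flat 0\<close>, and with it those of the cut-offs in the next lemma.\<close>
lemma flat_2_bounds: "0 \<le> flat 2 y" "flat 2 y \<le> 2"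
proof -
  show "0 \<le> flat 2 y" by (simp add: flat_def)
  show "flat 2 y \<le> 2"
  proof (cases "y > 0")
    case True
    have "(1 / y)\<^sup>2 / 2 \<le> exp (1 / y)"
      using exp_lower_Taylor_quadratic[of "1 / y"] True zero_less_divide_1_iff[of y] by linarith
    then have "(1 / y)\<^sup>2 * exp (- 1 / y) \<le> 2 * exp (1 / y) * exp (- 1 / y)"
      by (intro mult_right_mono) auto
    also have "\<dots> = 2" by (simp add: exp_minus)
    finally show ?thesis using True by (simp add: flat_def power_divide)
  qed (simp add: flat_def)
qed

text \<open>
  The test functions are the products of \<open>\<kappa>\<close> with the widening cut-offs \<open>\<eta> n x = \<eta> 0 (x / (n + 1))\<close>.
  These converge to the constant \<open>\<eta> 0 0\<close>, which is not \<open>1\<close> but cancels at the end, and their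
  derivatives are of order \<open>1 / (n + 1)\<close>.
\<close>
lemma weak_derivative_integral_by_parts:
  fixes u v \<kappa> :: "real \<Rightarrow> real"
  assumes weak: "\<And>\<phi>. test_function \<phi> \<Longrightarrow>
      (LINT x|lborel. deriv \<phi> x * u x) = - (LINT x|lborel. \<phi> x * v x)"
    and meas [measurable]: "u \<in> borel_measurable borel" "v \<in> borel_measurable borel"
    and \<kappa>: "smooth_class \<kappa>"
    and int: "integrable lborel (\<lambda>x. \<kappa> x * u x)" "integrable lborel (\<lambda>x. deriv \<kappa> x * u x)"
      "integrable lborel (\<lambda>x. \<kappa> x * v x)"
  shows "(LINT x|lborel. deriv \<kappa> x * u x) = - (LINT x|lborel. \<kappa> x * v x)"
proof -
  define \<eta> where "\<eta> n = bump (1 / real (Suc n)) (- real (Suc n)) (real (Suc n))" for n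
  have \<eta>_eq: "\<eta> n x = flat 0 (x / real (Suc n) + 1) * flat 0 (1 - x / real (Suc n))" for n x
  proof -
    have "1 / N * x + - (1 / N) * - N = x / N + 1" "- (1 / N) * x + 1 / N * N = 1 - x / N"
      if "N \<noteq> 0" for N :: real
      using that by (simp_all add: field_simps)
    from this[of "real (Suc n)"] show ?thesis by (simp add: \<eta>_def bump_def)
  qed
  define \<eta>' where "\<eta>' n x = (flat 2 (x / real (Suc n) + 1) * flat 0 (1 - x / real (Suc n))
      - flat 2 (1 - x / real (Suc n)) * flat 0 (x / real (Suc n) + 1)) / real (Suc n)" for n x
  have \<eta>_smooth: "smooth_class (\<eta> n)" for n
    unfolding \<eta>_def by (rule smooth_class_bump)
  have \<eta>_deriv: "DERIV (\<eta> n) x :> \<eta>' n x" for n x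
  proof -
    have 1: "DERIV (\<lambda>x. x / real (Suc n) + 1) x :> 1 / real (Suc n)"
      and 2: "DERIV (\<lambda>x. 1 - x / real (Suc n)) x :> - (1 / real (Suc n))"
      by (auto intro!: derivative_eq_intros)
    have D: "DERIV (flat 0) y :> flat 2 y" for y
      using DERIV_flat[of 0 y] by (simp add: numeral_2_eq_2)
    show ?thesis
      using DERIV_mult[OF DERIV_chain2[OF D 1] DERIV_chain2[OF D 2]]
      unfolding \<eta>_eq[abs_def] \<eta>'_def by (rule DERIV_cong) (simp add: diff_divide_distrib)
  qed
  have \<eta>_le: "\<bar>\<eta> n x\<bar> \<le> 1" for n x
    using bump_bounds by (simp add: \<eta>_def)
  have \<eta>'_le: "\<bar>\<eta>' n x\<bar> \<le> 2 / real (Suc n)" for n x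
  proof -
    define p where "p = flat 2 (x / real (Suc n) + 1) * flat 0 (1 - x / real (Suc n))"
    define q where "q = flat 2 (1 - x / real (Suc n)) * flat 0 (x / real (Suc n) + 1)"
    have "0 \<le> p" "p \<le> 2 * 1" "0 \<le> q" "q \<le> 2 * 1"
      unfolding p_def q_def using flat_2_bounds flat_0_bounds
      by (auto intro!: mult_nonneg_nonneg mult_mono simp del: mult_1_right)
    then have "\<bar>p - q\<bar> \<le> 2" by linarith
    then have "\<bar>p - q\<bar> / real (Suc n) \<le> 2 / real (Suc n)" by (intro divide_right_mono) auto
    then show ?thesis by (simp add: \<eta>'_def p_def q_def)
  qed
  note [measurable] = smooth_class_measurable[OF \<eta>_smooth] smooth_class_measurable[OF \<kappa>]
    smooth_class_measurable[OF smooth_class_deriv[OF \<kappa>]]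
  have \<eta>'_eq: "deriv (\<eta> n) = \<eta>' n" for n
    using \<eta>_deriv by (auto intro: DERIV_imp_deriv)
  have [measurable]: "\<eta>' n \<in> borel_measurable borel" for n
    using smooth_class_measurable[OF smooth_class_deriv[OF \<eta>_smooth, of n]] by (simp add: \<eta>'_eq)
  define c where "c = flat 0 1 * flat 0 1"
  have c: "c \<noteq> 0" by (simp add: c_def flat_def)
  have small: "(\<lambda>n. r / real (Suc n)) \<longlonglongrightarrow> 0" for r
    using tendsto_mult_right[OF LIMSEQ_inverse_real_of_nat, of r] by (simp add: divide_inverse mult.commute)
  have \<eta>_lim: "(\<lambda>n. \<eta> n x) \<longlonglongrightarrow> c" for x
    unfolding \<eta>_eq c_def
  proof (intro tendsto_mult)
    have cont: "isCont (flat 0) 1" using DERIV_flat DERIV_isCont by blast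
    have "(\<lambda>n. x / real (Suc n) + 1) \<longlonglongrightarrow> 0 + 1" "(\<lambda>n. 1 - x / real (Suc n)) \<longlonglongrightarrow> 1 - 0"
      by (intro tendsto_intros small)+
    then show "(\<lambda>n. flat 0 (x / real (Suc n) + 1)) \<longlonglongrightarrow> flat 0 1"
      "(\<lambda>n. flat 0 (1 - x / real (Suc n))) \<longlonglongrightarrow> flat 0 1"
      using isCont_tendsto_compose[OF cont] by auto
  qed
  have \<eta>'_lim: "(\<lambda>n. \<eta>' n x) \<longlonglongrightarrow> 0" for x
    by (rule Lim_null_comparison[OF always_eventually small[of 2]]) (use \<eta>'_le in auto)
  have "(LINT x|lborel. \<eta>' n x * (\<kappa> x * u x) + \<eta> n x * (deriv \<kappa> x * u x))
      = - (LINT x|lborel. \<eta> n x * (\<kappa> x * v x))" for n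
  proof -
    have "test_function (\<lambda>x. \<eta> n x * \<kappa> x)"
    proof (rule test_functionI[where R = "real (Suc n)"])
      show "smooth_class (\<lambda>x. \<eta> n x * \<kappa> x)" by (intro smooth_class.mult \<eta>_smooth \<kappa>)
      fix x assume "\<eta> n x * \<kappa> x \<noteq> 0"
      then have "- real (Suc n) < x \<and> x < real (Suc n)"
        using bump_outside[of "1 / real (Suc n)" "- real (Suc n)" x "real (Suc n)"] by (auto simp: \<eta>_def)
      then show "\<bar>x\<bar> \<le> real (Suc n)" by linarith
    qed
    moreover have "deriv (\<lambda>x. \<eta> n x * \<kappa> x) x = \<eta>' n x * \<kappa> x + deriv \<kappa> x * \<eta> n x" for x
      by (intro DERIV_imp_deriv DERIV_mult \<eta>_deriv smooth_class_DERIV \<kappa>)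
    ultimately show ?thesis using weak[of "\<lambda>x. \<eta> n x * \<kappa> x"] by (simp add: algebra_simps)
  qed
  moreover have "(\<lambda>n. LINT x|lborel. \<eta>' n x * (\<kappa> x * u x) + \<eta> n x * (deriv \<kappa> x * u x))
      \<longlonglongrightarrow> (LINT x|lborel. 0 * (\<kappa> x * u x) + c * (deriv \<kappa> x * u x))"
  proof (rule integral_dominated_convergence[where w = "\<lambda>x. 2 * norm (\<kappa> x * u x) + norm (deriv \<kappa> x * u x)"])
    show "integrable lborel (\<lambda>x. 2 * norm (\<kappa> x * u x) + norm (deriv \<kappa> x * u x))"
      by (intro Bochner_Integration.integrable_add integrable_mult_right integrable_norm int)
    show "AE x in lborel. (\<lambda>n. \<eta>' n x * (\<kappa> x * u x) + \<eta> n x * (deriv \<kappa> x * u x))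
      \<longlonglongrightarrow> 0 * (\<kappa> x * u x) + c * (deriv \<kappa> x * u x)"
      by (intro AE_I2 tendsto_intros \<eta>_lim \<eta>'_lim)
    show "AE x in lborel. norm (\<eta>' n x * (\<kappa> x * u x) + \<eta> n x * (deriv \<kappa> x * u x))
        \<le> 2 * norm (\<kappa> x * u x) + norm (deriv \<kappa> x * u x)" for n
    proof (rule AE_I2)
      fix x
      have "2 / real (Suc n) \<le> 2" by (simp add: field_simps)
      then have "\<bar>\<eta>' n x\<bar> * \<bar>\<kappa> x * u x\<bar> \<le> 2 * \<bar>\<kappa> x * u x\<bar>" "\<bar>\<eta> n x\<bar> * \<bar>deriv \<kappa> x * u x\<bar> \<le> 1 * \<bar>deriv \<kappa> x * u x\<bar>"
        using \<eta>'_le[of n x] \<eta>_le[of n x] by (intro mult_right_mono; simp)+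
      then show "norm (\<eta>' n x * (\<kappa> x * u x) + \<eta> n x * (deriv \<kappa> x * u x))
        \<le> 2 * norm (\<kappa> x * u x) + norm (deriv \<kappa> x * u x)"
        using abs_triangle_ineq[of "\<eta>' n x * (\<kappa> x * u x)" "\<eta> n x * (deriv \<kappa> x * u x)"]
        unfolding real_norm_def abs_mult[of "\<eta>' n x"] abs_mult[of "\<eta> n x"] by linarith
    qed
  qed measurable
  moreover have "(\<lambda>n. - (LINT x|lborel. \<eta> n x * (\<kappa> x * v x))) \<longlonglongrightarrow> - (LINT x|lborel. c * (\<kappa> x * v x))"
  proof (intro tendsto_minus integral_dominated_convergence[where w = "\<lambda>x. norm (\<kappa> x * v x)"])
    show "integrable lborel (\<lambda>x. norm (\<kappa> x * v x))"
      by (intro integrable_norm int)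
    show "AE x in lborel. (\<lambda>n. \<eta> n x * (\<kappa> x * v x)) \<longlonglongrightarrow> c * (\<kappa> x * v x)"
      by (intro AE_I2 tendsto_intros \<eta>_lim)
    show "AE x in lborel. norm (\<eta> n x * (\<kappa> x * v x)) \<le> norm (\<kappa> x * v x)" for n
      using mult_right_mono[OF \<eta>_le, of "\<bar>\<kappa> x * v x\<bar>" n x for x] by (simp add: abs_mult)
  qed measurable
  ultimately have "(LINT x|lborel. 0 * (\<kappa> x * u x) + c * (deriv \<kappa> x * u x)) = - (LINT x|lborel. c * (\<kappa> x * v x))"
    by (simp only: LIMSEQ_unique)
  then show ?thesis using c by (simp add: eq_neg_iff_add_eq_0 flip: distrib_left)
qed

text \<open>Test functions are real, so the real and imaginary parts of \<open>1 / (x - z)\<close> are treated separately.\<close>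
lemma weak_derivative_cauchy_kernel:
  fixes u v :: "real \<Rightarrow> real" and z :: complex
  assumes weak: "\<And>\<phi>. test_function \<phi> \<Longrightarrow>
      (LINT x|lborel. deriv \<phi> x * u x) = - (LINT x|lborel. \<phi> x * v x)"
    and u: "square_integrable lborel (\<lambda>x. complex_of_real (u x))"
    and v: "square_integrable lborel (\<lambda>x. complex_of_real (v x))"
    and z: "Im z \<noteq> 0"
  shows "(LINT x|lborel. v x / (of_real x - z)) = (LINT x|lborel. u x / (of_real x - z)\<^sup>2)"
proof -
  have [measurable]: "u \<in> borel_measurable borel" "v \<in> borel_measurable borel"
    using measurable_compose[OF square_integrable_measurable[OF u] borel_measurable_Re]
      measurable_compose[OF square_integrable_measurable[OF v] borel_measurable_Re] by simp_all
  have nz: "complex_of_real x - z \<noteq> 0" for x by (rule real_minus_complex_nonzero[OF z])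
  have int_u: "integrable lborel (\<lambda>x. u x / (of_real x - z))"
    and int_v: "integrable lborel (\<lambda>x. v x / (of_real x - z))"
    and int_u2: "integrable lborel (\<lambda>x. u x / (of_real x - z)\<^sup>2)"
    using integrable_divide_shift[OF square_integrable_divide_shift[OF u z] z]
      integrable_divide_shift[OF u z] integrable_divide_shift[OF v z] by (simp_all add: power2_eq_square)
  have der: "((\<lambda>x. 1 / (of_real x - z)) has_vector_derivative - (1 / (of_real x - z)\<^sup>2)) (at x)" for x
  proof -
    have "((\<lambda>y. 1 / (y - z)) has_field_derivative - (1 / (of_real x - z)\<^sup>2)) (at (of_real x))"
      using nz[of x] by (auto intro!: derivative_eq_intros simp: power2_eq_square)
    from has_vector_derivative_real_field[OF this] show ?thesis .
  qed
  define \<kappa>1 where "\<kappa>1 x = (x + - Re z) * (1 / ((x - Re z)\<^sup>2 + (Im z)\<^sup>2))" for x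
  define \<kappa>2 where "\<kappa>2 x = Im z * (1 / ((x - Re z)\<^sup>2 + (Im z)\<^sup>2))" for x
  have sm: "smooth_class \<kappa>1" "smooth_class \<kappa>2"
    unfolding \<kappa>1_def[abs_def] \<kappa>2_def[abs_def] by (intro smooth_class.intros z)+
  have \<kappa>: "\<kappa>1 x = Re (1 / (of_real x - z))" "\<kappa>2 x = Im (1 / (of_real x - z))" for x
    by (simp_all add: \<kappa>1_def \<kappa>2_def Re_divide Im_divide)
  have "DERIV \<kappa>1 x :> Re (- (1 / (of_real x - z)\<^sup>2))" "DERIV \<kappa>2 x :> Im (- (1 / (of_real x - z)\<^sup>2))" for x
    unfolding \<kappa>[abs_def] has_real_derivative_iff_has_vector_derivative
    by (intro bounded_linear.has_vector_derivative[OF bounded_linear_Re] bounded_linear.has_vector_derivative[OF bounded_linear_Im] der)+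
  then have der\<kappa>: "deriv \<kappa>1 x = Re (- (1 / (of_real x - z)\<^sup>2))" "deriv \<kappa>2 x = Im (- (1 / (of_real x - z)\<^sup>2))" for x
    by (auto intro: DERIV_imp_deriv)
  have re: "Re (w * of_real r) = Re w * r" "Im (w * of_real r) = Im w * r" for w r by simp_all
  have e: "\<kappa>1 x * r = Re (r / (of_real x - z))" "\<kappa>2 x * r = Im (r / (of_real x - z))"
    "deriv \<kappa>1 x * r = - Re (r / (of_real x - z)\<^sup>2)" "deriv \<kappa>2 x * r = - Im (r / (of_real x - z)\<^sup>2)" for x r
    using re[of "1 / (of_real x - z)" r] re[of "1 / (of_real x - z)\<^sup>2" r] unfolding \<kappa> der\<kappa> by simp_all
  have "(LINT x|lborel. deriv \<kappa>1 x * u x) = - (LINT x|lborel. \<kappa>1 x * v x)"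
    by (rule weak_derivative_integral_by_parts[OF weak])
       (use sm int_u int_v int_u2 in \<open>auto simp only: e intro!: integrable_minus integrable_Re integrable_Im\<close>, measurable)
  moreover have "(LINT x|lborel. deriv \<kappa>2 x * u x) = - (LINT x|lborel. \<kappa>2 x * v x)"
    by (rule weak_derivative_integral_by_parts[OF weak])
       (use sm int_u int_v int_u2 in \<open>auto simp only: e intro!: integrable_minus integrable_Re integrable_Im\<close>, measurable)
  ultimately show ?thesis
    unfolding e using int_u2 int_v by (simp add: complex_eq_iff)
qed

lemma test_function_continuous:
  assumes "test_function \<phi>"
  shows "continuous_on UNIV \<phi>" "continuous_on UNIV (deriv \<phi>)"
proof -
  have "(deriv ^^ k) \<phi> field_differentiable (at x)" for k x
    using assms by (simp add: test_function_def)
  then have "continuous_on UNIV ((deriv ^^ k) \<phi>)" for k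
    by (auto simp: continuous_on_eq_continuous_at field_differentiable_imp_continuous_at)
  from this[of 0] this[of 1] show "continuous_on UNIV \<phi>" "continuous_on UNIV (deriv \<phi>)" by simp_all
qed

lemma deriv_zero_outside_support:
  fixes \<phi> :: "real \<Rightarrow> real"
  assumes "x \<notin> closure {x. \<phi> x \<noteq> 0}"
  shows "deriv \<phi> x = (0::real)"
proof (rule DERIV_imp_deriv)
  have "((\<lambda>_. 0) has_field_derivative 0) (at x)" by simp
  then show "DERIV \<phi> x :> 0"
  proof (rule has_field_derivative_transform_within_open)
    show "open (- closure {x. \<phi> x \<noteq> 0})" by (rule open_Compl[OF closed_closure])
    show "x \<in> - closure {x. \<phi> x \<noteq> 0}" using assms by simp
    show "0 = \<phi> y" if "y \<in> - closure {x. \<phi> x \<noteq> 0}" for y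
      using that closure_subset[of "{x. \<phi> x \<noteq> 0}"] by auto
  qed
qed

text \<open>Integrability is what allows the components of a vector-valued integral to be taken under the integral sign.\<close>
lemma integrable_continuous_compact_support_scaleR:
  fixes f :: "real \<Rightarrow> 'a::euclidean_space"
  assumes f: "locally_integrable f" and c: "continuous_on UNIV (c :: real \<Rightarrow> real)"
    and K: "compact K" "\<And>x. x \<notin> K \<Longrightarrow> c x = 0"
  shows "integrable lebesgue (\<lambda>x. c x *\<^sub>R f x)"
proof -
  have "bounded (c ` K)"
    using c K(1) by (meson compact_continuous_image compact_imp_bounded continuous_on_subset subset_UNIV)
  then obtain B where B: "\<And>x. x \<in> K \<Longrightarrow> \<bar>c x\<bar> \<le> B" by (auto simp: bounded_iff)
  have "set_integrable lebesgue K f" using f K(1) by (simp add: locally_integrable_def)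
  then have "integrable lebesgue (\<lambda>x. B * norm (indicator K x *\<^sub>R f x))"
    unfolding set_integrable_def by (intro integrable_mult_right integrable_norm)
  then show ?thesis
  proof (rule Bochner_Integration.integrable_bound)
    have "c \<in> borel_measurable lebesgue"
      using c by (intro measurable_completion) (simp add: borel_measurable_continuous_onI)
    then show "(\<lambda>x. c x *\<^sub>R f x) \<in> borel_measurable lebesgue"
      by (rule borel_measurable_scaleR[OF _ locally_integrable_measurable[OF f]])
    show "AE x in lebesgue. norm (c x *\<^sub>R f x) \<le> norm (B * norm (indicator K x *\<^sub>R f x))"
    proof (rule AE_I2)
      fix x
      show "norm (c x *\<^sub>R f x) \<le> norm (B * norm (indicator K x *\<^sub>R f x))"
        using B[of x] K(2)[of x] by (cases "x \<in> K") (auto simp: abs_mult intro!: mult_right_mono)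
    qed
  qed
qed

lemma weak_derivative_component:
  fixes u v :: "real \<Rightarrow> real ^ 'm"
  assumes W: "has_weak_derivative u v" and \<phi>: "test_function \<phi>"
  shows "(LINT x|lebesgue. deriv \<phi> x * (u x $ i)) = - (LINT x|lebesgue. \<phi> x * (v x $ i))"
proof -
  define K where "K = closure {x. \<phi> x \<noteq> 0}"
  have K: "compact K" using \<phi> by (simp add: K_def test_function_def)
  have out: "\<phi> x = 0" "deriv \<phi> x = 0" if "x \<notin> K" for x
    using that closure_subset[of "{x. \<phi> x \<noteq> 0}"] deriv_zero_outside_support[of x \<phi>] by (auto simp: K_def)
  have loc: "locally_integrable u" "locally_integrable v" using W by (auto simp: has_weak_derivative_def)
  have "(LINT x|lebesgue. deriv \<phi> x *\<^sub>R u x) $ i = (- (LINT x|lebesgue. \<phi> x *\<^sub>R v x)) $ i"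
    using W \<phi> by (simp add: has_weak_derivative_def)
  moreover have "(LINT x|lebesgue. (deriv \<phi> x *\<^sub>R u x) $ i) = (LINT x|lebesgue. deriv \<phi> x *\<^sub>R u x) $ i"
    by (intro integral_bounded_linear[OF bounded_linear_vec_nth]
        integrable_continuous_compact_support_scaleR[OF loc(1) test_function_continuous(2)[OF \<phi>] K out(2)])
  moreover have "(LINT x|lebesgue. (\<phi> x *\<^sub>R v x) $ i) = (LINT x|lebesgue. \<phi> x *\<^sub>R v x) $ i"
    by (intro integral_bounded_linear[OF bounded_linear_vec_nth]
        integrable_continuous_compact_support_scaleR[OF loc(2) test_function_continuous(1)[OF \<phi>] K out(1)])
  ultimately show ?thesis by simp
qed

section \<open>The half-Laplacian and the Cauchy kernel\<close>

text \<open>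
  The multiplication formula \<open>\<integral> F f \<cdot> \<phi> = \<integral> f \<cdot> F \<phi>\<close>.  It holds for the truncated transforms by Fubini's
  theorem, and both sides converge: the left one by the Cauchy-Schwarz inequality, because \<open>g\<close> is
  the \<open>L\<^sup>2\<close> limit of the truncated transforms, the right one by domination.
\<close>
lemma fourier_L2_pairing:
  assumes F: "has_fourier_L2 f g" and f_meas: "f \<in> borel_measurable borel"
    and \<phi>: "integrable lborel \<phi>" "square_integrable lborel \<phi>"
    and \<psi>: "square_integrable lborel \<psi>"
    and trans: "\<And>x. (LINT \<xi>|lborel. exp (- \<i> * of_real (x * \<xi>)) * \<phi> \<xi>) = \<psi> x"
  shows "(LINT \<xi>|lebesgue. g \<xi> * \<phi> \<xi>) = (LINT x|lborel. f x * \<psi> x)"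
proof -
  note [measurable] = f_meas square_integrable_measurable[OF \<phi>(2)] square_integrable_measurable[OF \<psi>]
  have f: "square_integrable lborel f" and g: "square_integrable lebesgue g"
    using F f_meas by (auto simp: has_fourier_L2_def square_integrable_lebesgue_iff_L2
        intro: square_integrable_lebesgue_imp_lborel)
  have \<phi>': "square_integrable lebesgue \<phi>"
    by (rule square_integrable_lborel_imp_lebesgue[OF \<phi>(2)])
  define T where "T n = truncated_fourier (real n) f" for n
  have T_eq: "T n \<xi> = (LINT x|lborel. indicator {- real n..real n} x *\<^sub>R (exp (- \<i> * of_real (x * \<xi>)) * f x))" for n \<xi>
    unfolding T_def truncated_fourier_def set_lebesgue_integral_def
    by (intro integral_completion) measurable
  have T_meas [measurable]: "T n \<in> borel_measurable borel" for n
    unfolding T_eq[abs_def] by measurable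
  have T_leb: "T n \<in> borel_measurable lebesgue" for n
    by (intro measurable_completion) simp
  define N where "N n = (\<integral>\<^sup>+\<xi>. ennreal ((norm (T n \<xi> - g \<xi>))\<^sup>2) \<partial>lebesgue)" for n
  have N: "N \<longlonglongrightarrow> 0"
    unfolding N_def T_def using F filterlim_compose[OF _ filterlim_real_sequentially]
    by (auto simp: has_fourier_L2_def)
  have fin: "\<forall>\<^sub>F n in sequentially. N n < \<infinity>"
    using order_tendstoD(2)[OF N, of \<infinity>] by simp
  have diff: "square_integrable lebesgue (\<lambda>\<xi>. T n \<xi> - g \<xi>)"
    "(LINT \<xi>|lebesgue. (norm (T n \<xi> - g \<xi>))\<^sup>2) = enn2real (N n)" if "N n < \<infinity>" for n
  proof -
    have m: "(\<lambda>\<xi>. T n \<xi> - g \<xi>) \<in> borel_measurable lebesgue"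
      using T_leb square_integrable_measurable[OF g] by (intro borel_measurable_diff)
    show "square_integrable lebesgue (\<lambda>\<xi>. T n \<xi> - g \<xi>)"
      unfolding square_integrable_def
      using that m by (auto simp: N_def intro!: integrableI_bounded)
    then show "(LINT \<xi>|lebesgue. (norm (T n \<xi> - g \<xi>))\<^sup>2) = enn2real (N n)"
      using nn_integral_eq_integral[OF square_integrable_norm2, of lebesgue "\<lambda>\<xi>. T n \<xi> - g \<xi>"] by (simp add: N_def)
  qed
  have "(\<lambda>n. LINT \<xi>|lebesgue. (T n \<xi> - g \<xi>) * \<phi> \<xi>) \<longlonglongrightarrow> 0"
  proof -
    have "(\<lambda>n. enn2real (N n)) \<longlonglongrightarrow> 0"
      by (rule tendsto_enn2real) (use N in simp_all)
    then have lim: "(\<lambda>n. enn2real (N n) * (LINT \<xi>|lebesgue. (norm (\<phi> \<xi>))\<^sup>2)) \<longlonglongrightarrow> 0 * (LINT \<xi>|lebesgue. (norm (\<phi> \<xi>))\<^sup>2)"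
      by (intro tendsto_mult tendsto_const)
    have "\<forall>\<^sub>F n in sequentially. norm ((norm (LINT \<xi>|lebesgue. (T n \<xi> - g \<xi>) * \<phi> \<xi>))\<^sup>2)
        \<le> enn2real (N n) * (LINT \<xi>|lebesgue. (norm (\<phi> \<xi>))\<^sup>2)"
      using fin
    proof eventually_elim
      case (elim n)
      show ?case
        using norm_integral_mult_le[OF diff(1)[OF elim] \<phi>'] unfolding diff(2)[OF elim] by simp
    qed
    then have "(\<lambda>n. (norm (LINT \<xi>|lebesgue. (T n \<xi> - g \<xi>) * \<phi> \<xi>))\<^sup>2) \<longlonglongrightarrow> 0"
      by (rule Lim_null_comparison) (use lim in simp)
    then have "(\<lambda>n. sqrt ((norm (LINT \<xi>|lebesgue. (T n \<xi> - g \<xi>) * \<phi> \<xi>))\<^sup>2)) \<longlonglongrightarrow> sqrt 0"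
      by (intro tendsto_intros)
    then show ?thesis by (simp add: tendsto_norm_zero_iff)
  qed
  then have "(\<lambda>n. (LINT \<xi>|lebesgue. (T n \<xi> - g \<xi>) * \<phi> \<xi>) + (LINT \<xi>|lebesgue. g \<xi> * \<phi> \<xi>))
      \<longlonglongrightarrow> 0 + (LINT \<xi>|lebesgue. g \<xi> * \<phi> \<xi>)"
    by (intro tendsto_intros)
  moreover have "\<forall>\<^sub>F n in sequentially. (LINT \<xi>|lebesgue. (T n \<xi> - g \<xi>) * \<phi> \<xi>) + (LINT \<xi>|lebesgue. g \<xi> * \<phi> \<xi>)
      = (LINT x|lborel. indicator {- real n..real n} x *\<^sub>R (f x * \<psi> x))"
    using fin
  proof eventually_elim
    case (elim n)
    have "(LINT \<xi>|lebesgue. (T n \<xi> - g \<xi>) * \<phi> \<xi>) + (LINT \<xi>|lebesgue. g \<xi> * \<phi> \<xi>)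
        = (LINT \<xi>|lebesgue. (T n \<xi> - g \<xi>) * \<phi> \<xi> + g \<xi> * \<phi> \<xi>)"
      by (intro Bochner_Integration.integral_add[symmetric] integrable_mult_square_integrable diff elim g \<phi>')
    also have "\<dots> = (LINT \<xi>|lebesgue. T n \<xi> * \<phi> \<xi>)" by (simp add: algebra_simps)
    also have "\<dots> = (LINT \<xi>|lborel. T n \<xi> * \<phi> \<xi>)"
      by (intro integral_completion) measurable
    also have "\<dots> = (LINT x|lborel. indicator {- real n..real n} x *\<^sub>R (f x * \<psi> x))"
    proof -
      define G where "G x \<xi> = (complex_of_real (indicator {- real n..real n} x) * f x) * (exp (- \<i> * of_real (x * \<xi>)) * \<phi> \<xi>)" for x \<xi>
      have ind2: "square_integrable lborel (\<lambda>x. complex_of_real (indicator {- real n..real n} x))"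
        unfolding square_integrable_def by (auto simp: power2_eq_square emeasure_lborel_Icc_eq simp flip: indicator_inter_arith)
      have int_f: "integrable lborel (\<lambda>x. complex_of_real (indicator {- real n..real n} x) * f x)"
        using integrable_mult_square_integrable[OF ind2 f] by simp
      have int: "integrable (lborel \<Otimes>\<^sub>M lborel) (case_prod G)"
      proof (rule integrable_lborel_pairI)
        show "case_prod G \<in> borel_measurable (lborel \<Otimes>\<^sub>M lborel)"
          unfolding G_def by measurable
        have e: "norm (exp (- \<i> * of_real (x * \<xi>))) = 1" for x \<xi> :: real
          using norm_exp_i_times[of "- (x * \<xi>)"] by simp
        show "integrable lborel (G x)" for x
          unfolding G_def
        proof (intro integrable_mult_right Bochner_Integration.integrable_bound[OF \<phi>(1)])
          show "AE \<xi> in lborel. norm (exp (- \<i> * of_real (x * \<xi>)) * \<phi> \<xi>) \<le> norm (\<phi> \<xi>)"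
            using e by (simp add: norm_mult)
        qed measurable
        show "(LINT \<xi>|lborel. norm (G x \<xi>)) \<le> norm (complex_of_real (indicator {- real n..real n} x) * f x) * (LINT \<xi>|lborel. norm (\<phi> \<xi>))" for x
          unfolding G_def norm_mult e by simp
        show "integrable lborel (\<lambda>x. norm (complex_of_real (indicator {- real n..real n} x) * f x) * (LINT \<xi>|lborel. norm (\<phi> \<xi>)))"
          by (intro integrable_mult_left integrable_norm int_f)
      qed
      have 1: "(LINT x|lborel. G x \<xi>) = T n \<xi> * \<phi> \<xi>" for \<xi>
      proof -
        have "G x \<xi> = indicator {- real n..real n} x *\<^sub>R (exp (- \<i> * of_real (x * \<xi>)) * f x) * \<phi> \<xi>" for x
          by (simp add: G_def indicator_def)
        then show ?thesis unfolding T_eq by (simp only: integral_mult_left_zero)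
      qed
      have 2: "(LINT \<xi>|lborel. G x \<xi>) = indicator {- real n..real n} x *\<^sub>R (f x * \<psi> x)" for x
        unfolding G_def integral_mult_right_zero trans by (simp add: indicator_def)
      show ?thesis using lborel_pair.Fubini_integral[OF int] unfolding 1 2 .
    qed
    finally show ?case .
  qed
  ultimately have "(\<lambda>n. LINT x|lborel. indicator {- real n..real n} x *\<^sub>R (f x * \<psi> x)) \<longlonglongrightarrow> 0 + (LINT \<xi>|lebesgue. g \<xi> * \<phi> \<xi>)"
    by (rule Lim_transform_eventually)
  moreover have "(\<lambda>n. LINT x|lborel. indicator {- real n..real n} x *\<^sub>R (f x * \<psi> x)) \<longlonglongrightarrow> (LINT x|lborel. f x * \<psi> x)"
  proof (rule integral_dominated_convergence[where w = "\<lambda>x. norm (f x * \<psi> x)"])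
    show "integrable lborel (\<lambda>x. norm (f x * \<psi> x))"
      by (intro integrable_norm integrable_mult_square_integrable f \<psi>)
    show "AE x in lborel. (\<lambda>n. indicator {- real n..real n} x *\<^sub>R (f x * \<psi> x)) \<longlonglongrightarrow> f x * \<psi> x"
    proof (rule AE_I2)
      fix x
      obtain m where "\<bar>x\<bar> < real m" using reals_Archimedean2 by blast
      then show "(\<lambda>n. indicator {- real n..real n} x *\<^sub>R (f x * \<psi> x)) \<longlonglongrightarrow> f x * \<psi> x"
        by (intro tendsto_eventually eventually_sequentiallyI[of m]) (auto simp: indicator_def)
    qed
  qed (auto simp: indicator_def)
  ultimately have "0 + (LINT \<xi>|lebesgue. g \<xi> * \<phi> \<xi>) = (LINT x|lborel. f x * \<psi> x)"
    by (rule LIMSEQ_unique)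
  then show ?thesis by simp
qed

lemma exp_decay_integrable:
  assumes a: "(a::real) > 0"
  shows "set_integrable lborel {0<..} (\<lambda>x. exp (- a * x))"
proof -
  have D: "DERIV (\<lambda>x. - exp (- a * x) / a) x :> exp (- a * x)" for x
    using a by (auto intro!: derivative_eq_intros)
  have "filterlim (\<lambda>x. a * x) at_top at_top"
    by (intro filterlim_tendsto_pos_mult_at_top[OF tendsto_const a] filterlim_ident)
  then have lim: "((\<lambda>x. exp (- (a * x))) \<longlongrightarrow> 0) at_top"
    by (intro filterlim_compose[OF exp_at_bot] filterlim_uminus_at_top[THEN iffD1])
  have "set_integrable lborel (einterval 0 \<infinity>) (\<lambda>x. exp (- a * x))"
  proof (rule interval_integral_FTC_nonneg(1)[where F = "\<lambda>x. - exp (- a * x) / a" and A = "- 1 / a" and B = 0])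
    have "((\<lambda>x. - exp (- a * x) / a) \<longlongrightarrow> - exp (- a * 0) / a) (at 0)"
      by (intro tendsto_intros) (use a in auto)
    then show "(((\<lambda>x. - exp (- a * x) / a) \<circ> real_of_ereal) \<longlongrightarrow> - 1 / a) (at_right 0)"
      unfolding zero_ereal_def ereal_tendsto_simps1 by (auto simp: filterlim_at_split)
    have "((\<lambda>x. - exp (- (a * x)) / a) \<longlongrightarrow> - 0 / a) at_top"
      by (intro tendsto_intros lim) (use a in auto)
    then show "(((\<lambda>x. - exp (- a * x) / a) \<circ> real_of_ereal) \<longlongrightarrow> 0) (at_left \<infinity>)"
      unfolding ereal_tendsto_simps1 by simp
  qed (use D in \<open>auto intro!: continuous_intros\<close>)
  then show ?thesis by (simp add: einterval_def greaterThan_def)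
qed

lemma exp_decay_bound_integrable:
  fixes \<phi> :: "real \<Rightarrow> complex"
  assumes a: "a > 0" and [measurable]: "\<phi> \<in> borel_measurable borel"
    and bound: "\<And>x. x > 0 \<Longrightarrow> norm (\<phi> x) \<le> K * exp (- a * x)" and zero: "\<And>x. x \<le> 0 \<Longrightarrow> \<phi> x = 0"
  shows "integrable lborel \<phi>" "square_integrable lborel \<phi>"
proof -
  have "integrable lborel (\<lambda>x. K * (indicator {0<..} x *\<^sub>R exp (- a * x)))"
    using exp_decay_integrable[OF a] unfolding set_integrable_def by (rule integrable_mult_right)
  then show "integrable lborel \<phi>"
  proof (rule Bochner_Integration.integrable_bound)
    show "AE x in lborel. norm (\<phi> x) \<le> norm (K * (indicator {0<..} x *\<^sub>R exp (- a * x)))"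
      using bound zero by (auto simp: indicator_def not_less intro!: AE_I2 order_trans[OF bound])
  qed simp
  have a2: "2 * a > 0" using a by simp
  have "integrable lborel (\<lambda>x. K\<^sup>2 * (indicator {0<..} x *\<^sub>R exp (- (2 * a) * x)))"
    using exp_decay_integrable[OF a2] unfolding set_integrable_def by (rule integrable_mult_right)
  then have "integrable lborel (\<lambda>x. (norm (\<phi> x))\<^sup>2)"
  proof (rule Bochner_Integration.integrable_bound)
    show "AE x in lborel. norm ((norm (\<phi> x))\<^sup>2) \<le> norm (K\<^sup>2 * (indicator {0<..} x *\<^sub>R exp (- (2 * a) * x)))"
    proof (rule AE_I2)
      fix x
      show "norm ((norm (\<phi> x))\<^sup>2) \<le> norm (K\<^sup>2 * (indicator {0<..} x *\<^sub>R exp (- (2 * a) * x)))"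
      proof (cases "x > 0")
        case True
        have "(norm (\<phi> x))\<^sup>2 \<le> (K * exp (- a * x))\<^sup>2"
          using bound[OF True] by (intro power_mono) auto
        also have "\<dots> = K\<^sup>2 * exp (- (2 * a) * x)"
          by (simp add: power_mult_distrib power2_eq_square flip: exp_add)
        finally show ?thesis using True by simp
      qed (use zero in simp)
    qed
  qed simp
  then show "square_integrable lborel \<phi>" by (simp add: square_integrable_def)
qed

definition half_line_exp :: "complex \<Rightarrow> real \<Rightarrow> complex" where
  "half_line_exp c x = indicator {0<..} x *\<^sub>R exp (- c * of_real x)"

lemma half_line_exp_measurable [measurable]: "half_line_exp c \<in> borel_measurable borel"
  unfolding half_line_exp_def[abs_def] by measurable

lemma norm_half_line_exp: "x > 0 \<Longrightarrow> norm (half_line_exp c x) = exp (- Re c * x)"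
  by (simp add: half_line_exp_def)

lemma mult_exp_decay_le:
  assumes "(a::real) > 0" "x > 0"
  shows "x * exp (- a * x) \<le> (2 / a) * exp (- (a / 2) * x)"
proof -
  have "a / 2 * x \<le> exp (a / 2 * x)" using exp_ge_add_one_self[of "a / 2 * x"] by linarith
  then have "x \<le> 2 / a * exp (a / 2 * x)" using assms by (simp add: field_simps)
  then have "x * exp (- a * x) \<le> 2 / a * exp (a / 2 * x) * exp (- a * x)" by (intro mult_right_mono) auto
  also have "\<dots> = 2 / a * exp (- (a / 2) * x)"
    by (simp add: mult.assoc flip: exp_add)
  finally show ?thesis .
qed

lemma half_line_exp_integrable:
  assumes "Re c > 0"
  shows "integrable lborel (half_line_exp c)" "square_integrable lborel (half_line_exp c)"
    "integrable lborel (\<lambda>x. of_real x * half_line_exp c x)"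
    "square_integrable lborel (\<lambda>x. of_real x * half_line_exp c x)"
proof -
  show "integrable lborel (half_line_exp c)" "square_integrable lborel (half_line_exp c)"
    by (rule exp_decay_bound_integrable[OF assms, where K = 1];
        use norm_half_line_exp in \<open>simp add: half_line_exp_def\<close>)+
  have b: "norm (of_real x * half_line_exp c x) \<le> (2 / Re c) * exp (- (Re c / 2) * x)" if "x > 0" for x
    using mult_exp_decay_le[OF assms that] norm_half_line_exp[OF that] that by (simp add: norm_mult)
  have h: "Re c / 2 > 0" using assms by simp
  have m: "(\<lambda>x. of_real x * half_line_exp c x) \<in> borel_measurable borel" by measurable
  show "integrable lborel (\<lambda>x. of_real x * half_line_exp c x)"
    "square_integrable lborel (\<lambda>x. of_real x * half_line_exp c x)"
    using exp_decay_bound_integrable[OF h m b] by (simp_all add: half_line_exp_def)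
qed

lemma integral_half_line_exp:
  assumes c: "Re c > 0"
  shows "(LINT x|lborel. half_line_exp c x) = 1 / c"
    and "(LINT x|lborel. of_real x * half_line_exp c x) = 1 / c\<^sup>2"
proof -
  have c0: "c \<noteq> 0" using c by auto
  have at: "filterlim (\<lambda>x. Re c * x) at_top at_top"
    by (intro filterlim_tendsto_pos_mult_at_top[OF tendsto_const c] filterlim_ident)
  have lim: "((\<lambda>x. exp (- c * of_real x)) \<longlongrightarrow> 0) at_top"
  proof (rule tendsto_norm_zero_cancel)
    have "((\<lambda>x. exp (- (Re c * x))) \<longlongrightarrow> 0) at_top"
      by (intro filterlim_compose[OF exp_at_bot] filterlim_uminus_at_top[THEN iffD1] at)
    then show "((\<lambda>x. norm (exp (- c * complex_of_real x))) \<longlongrightarrow> 0) at_top" by simp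
  qed
  have lim1: "((\<lambda>x. of_real x * exp (- c * of_real x)) \<longlongrightarrow> 0) at_top"
  proof (rule Lim_null_comparison)
    show "\<forall>\<^sub>F x in at_top. norm (of_real x * exp (- c * complex_of_real x)) \<le> (2 / Re c) * exp (- (Re c / 2) * x)"
      using eventually_gt_at_top[of 0]
    proof eventually_elim
      case (elim x)
      then show ?case using mult_exp_decay_le[OF c elim] by (simp add: norm_mult)
    qed
    have "filterlim (\<lambda>x. Re c / 2 * x) at_top at_top"
      by (intro filterlim_tendsto_pos_mult_at_top[OF tendsto_const] filterlim_ident) (use c in auto)
    then have "((\<lambda>x. exp (- (Re c / 2 * x))) \<longlongrightarrow> 0) at_top"
      by (intro filterlim_compose[OF exp_at_bot] filterlim_uminus_at_top[THEN iffD1])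
    then have "((\<lambda>x. (2 / Re c) * exp (- (Re c / 2 * x))) \<longlongrightarrow> (2 / Re c) * 0) at_top"
      by (intro tendsto_intros)
    then show "((\<lambda>x. (2 / Re c) * exp (- (Re c / 2) * x)) \<longlongrightarrow> 0) at_top" by simp
  qed
  have half: "(LBINT x=0..\<infinity>. f x) = (LINT x|lborel. indicator {0<..} x *\<^sub>R f x)" for f :: "real \<Rightarrow> complex"
    using interval_integral_to_infinity_eq[of lborel 0 f] by (simp add: set_lebesgue_integral_def zero_ereal_def)
  have int: "set_integrable lborel (einterval 0 \<infinity>) (\<lambda>x. exp (- c * of_real x))"
    "set_integrable lborel (einterval 0 \<infinity>) (\<lambda>x. of_real x * exp (- c * of_real x))"
    using half_line_exp_integrable(1,3)[OF c]
    by (simp_all add: set_integrable_def half_line_exp_def[abs_def] einterval_def greaterThan_def)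
  have "(LBINT x=0..\<infinity>. exp (- c * of_real x)) = 0 - (- 1 / c)"
  proof (rule interval_integral_FTC_integrable[where F = "\<lambda>x. - exp (- c * of_real x) / c"])
    fix x
    have "((\<lambda>z. - exp (- c * z) / c) has_field_derivative exp (- c * of_real x)) (at (of_real x))"
      using c0 by (auto intro!: derivative_eq_intros)
    from has_vector_derivative_real_field[OF this]
    show "((\<lambda>x. - exp (- c * complex_of_real x) / c) has_vector_derivative exp (- c * of_real x)) (at x)" .
  next
    have "((\<lambda>x. - exp (- c * of_real x) / c) \<longlongrightarrow> - exp (- c * of_real 0) / c) (at 0)"
      by (intro tendsto_intros) (use c0 in auto)
    then show "(((\<lambda>x. - exp (- c * of_real x) / c) \<circ> real_of_ereal) \<longlongrightarrow> - 1 / c) (at_right 0)"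
      unfolding zero_ereal_def ereal_tendsto_simps1 by (auto simp: filterlim_at_split)
    have "((\<lambda>x. - exp (- c * of_real x) / c) \<longlongrightarrow> - 0 / c) at_top"
      by (intro tendsto_intros lim) (use c0 in auto)
    then show "(((\<lambda>x. - exp (- c * of_real x) / c) \<circ> real_of_ereal) \<longlongrightarrow> 0) (at_left \<infinity>)"
      unfolding ereal_tendsto_simps1 by simp
  qed (use int in \<open>auto intro!: continuous_intros\<close>)
  then show "(LINT x|lborel. half_line_exp c x) = 1 / c"
    by (simp add: half half_line_exp_def)
  let ?F = "\<lambda>x. - (x * exp (- c * x)) / c - exp (- c * x) / c\<^sup>2"
  have "(LBINT x=0..\<infinity>. of_real x * exp (- c * of_real x)) = 0 - (- 1 / c\<^sup>2)"
  proof (rule interval_integral_FTC_integrable[where F = "\<lambda>x. ?F (of_real x)"])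
    fix x
    have "(?F has_field_derivative of_real x * exp (- c * of_real x)) (at (of_real x))"
      using c0 by (auto intro!: derivative_eq_intros simp: power2_eq_square field_simps)
    from has_vector_derivative_real_field[OF this]
    show "((\<lambda>x. ?F (of_real x)) has_vector_derivative of_real x * exp (- c * of_real x)) (at x)" .
  next
    have "((\<lambda>x. ?F (of_real x)) \<longlongrightarrow> ?F (of_real 0)) (at (0::real))"
      by (intro tendsto_intros) (use c0 in auto)
    then show "(((\<lambda>x. ?F (of_real x)) \<circ> real_of_ereal) \<longlongrightarrow> - 1 / c\<^sup>2) (at_right 0)"
      unfolding zero_ereal_def ereal_tendsto_simps1 by (auto simp: filterlim_at_split)
    have "((\<lambda>x::real. ?F (of_real x)) \<longlongrightarrow> - 0 / c - 0 / c\<^sup>2) at_top"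
      by (intro tendsto_intros lim lim1) (use c0 in auto)
    then show "(((\<lambda>x. ?F (of_real x)) \<circ> real_of_ereal) \<longlongrightarrow> 0) (at_left \<infinity>)"
      unfolding ereal_tendsto_simps1 by simp
  qed (use int in \<open>auto intro!: continuous_intros\<close>)
  then show "(LINT x|lborel. of_real x * half_line_exp c x) = 1 / c\<^sup>2"
    by (simp add: half half_line_exp_def)
qed

text \<open>
  With \<open>\<phi> \<xi> = e\<^bsup>\<i>p\<xi>\<^esup>\<close> on the positive half-line, \<open>\<bar>\<xi>\<bar> \<phi> \<xi> = \<xi> \<phi> \<xi>\<close>, and the transforms of \<open>\<phi>\<close> and \<open>\<xi> \<phi>\<close> are
  \<open>- \<i> / (x - p)\<close> and \<open>- 1 / (x - p)\<^sup>2\<close>.  Pairing the first with \<open>w\<close> and the second with \<open>u\<close> gives the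
  same integral on the Fourier side.
\<close>
lemma half_laplacian_cauchy_kernel:
  assumes H: "has_multiplier_image (\<lambda>\<xi>. \<bar>\<xi>\<bar>) u w"
    and meas [measurable]: "u \<in> borel_measurable borel" "w \<in> borel_measurable borel" and p: "Im p > 0"
  shows "(LINT x|lborel. w x / (of_real x - p)) = - \<i> * (LINT x|lborel. u x / (of_real x - p)\<^sup>2)"
proof -
  obtain g where g: "has_fourier_L2 (\<lambda>x. of_real (u x)) g"
    "has_fourier_L2 (\<lambda>x. of_real (w x)) (\<lambda>\<xi>. of_real \<bar>\<xi>\<bar> * g \<xi>)"
    using H by (auto simp: has_multiplier_image_def)
  define \<phi> where "\<phi> = half_line_exp (- \<i> * p)"
  have c: "Re (- \<i> * p) > 0" using p by simp
  have p0: "Im p \<noteq> 0" using p by simp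
  have shift: "exp (- \<i> * of_real (x * \<xi>)) * \<phi> \<xi> = half_line_exp (\<i> * (of_real x - p)) \<xi>" for x \<xi>
  proof -
    have "exp (- \<i> * of_real (x * \<xi>)) * exp (- (- \<i> * p) * of_real \<xi>) = exp (- (\<i> * (of_real x - p)) * of_real \<xi>)"
      unfolding exp_add[symmetric] by (simp add: algebra_simps)
    then show ?thesis by (simp add: \<phi>_def half_line_exp_def)
  qed
  have Rc: "Re (\<i> * (complex_of_real x - p)) > 0" for x using p by simp
  have ii: "1 / (\<i> * y) = - \<i> * (1 / y)" "1 / (\<i> * y)\<^sup>2 = - (1 / y\<^sup>2)" for y :: complex
    by (auto simp: power_mult_distrib divide_simps)
  have E1: "(LINT \<xi>|lebesgue. of_real \<bar>\<xi>\<bar> * g \<xi> * \<phi> \<xi>) = (LINT x|lborel. of_real (w x) * (- \<i> * (1 / (of_real x - p))))"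
  proof (rule fourier_L2_pairing[OF g(2)])
    show "integrable lborel \<phi>" "square_integrable lborel \<phi>"
      unfolding \<phi>_def by (rule half_line_exp_integrable[OF c])+
    show "square_integrable lborel (\<lambda>x. - \<i> * (1 / (of_real x - p)))"
      by (intro square_integrable_cmult square_integrable_cauchy_kernel p0)
    show "(LINT \<xi>|lborel. exp (- \<i> * of_real (x * \<xi>)) * \<phi> \<xi>) = - \<i> * (1 / (of_real x - p))" for x
      unfolding shift integral_half_line_exp(1)[OF Rc] ii ..
  qed simp
  have E2: "(LINT \<xi>|lebesgue. g \<xi> * (of_real \<xi> * \<phi> \<xi>)) = (LINT x|lborel. of_real (u x) * (- (1 / (of_real x - p)\<^sup>2)))"
  proof (rule fourier_L2_pairing[OF g(1)])
    show "integrable lborel (\<lambda>\<xi>. of_real \<xi> * \<phi> \<xi>)" "square_integrable lborel (\<lambda>\<xi>. of_real \<xi> * \<phi> \<xi>)"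
      unfolding \<phi>_def by (rule half_line_exp_integrable[OF c])+
    have "square_integrable lborel (\<lambda>x. - 1 * (1 / (of_real x - p) / (of_real x - p)))"
      by (intro square_integrable_cmult square_integrable_divide_shift square_integrable_cauchy_kernel p0)
    then show "square_integrable lborel (\<lambda>x. - (1 / (of_real x - p)\<^sup>2))" by (simp add: power2_eq_square)
    have "exp (- \<i> * of_real (x * \<xi>)) * (of_real \<xi> * \<phi> \<xi>) = of_real \<xi> * half_line_exp (\<i> * (of_real x - p)) \<xi>" for x \<xi>
      unfolding shift[symmetric] by (simp add: mult_ac)
    then show "(LINT \<xi>|lborel. exp (- \<i> * of_real (x * \<xi>)) * (of_real \<xi> * \<phi> \<xi>)) = - (1 / (of_real x - p)\<^sup>2)" for x
      by (simp only: integral_half_line_exp(2)[OF Rc] ii)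
  qed simp
  have E3: "of_real \<bar>\<xi>\<bar> * g \<xi> * \<phi> \<xi> = g \<xi> * (of_real \<xi> * \<phi> \<xi>)" for \<xi>
    by (cases "\<xi> > 0") (simp_all add: \<phi>_def half_line_exp_def)
  have "of_real (w x) * (- \<i> * (1 / (of_real x - p))) = - \<i> * (of_real (w x) / (of_real x - p))"
    "of_real (u x) * (- (1 / (of_real x - p)\<^sup>2)) = - (of_real (u x) / (of_real x - p)\<^sup>2)" for x
    by simp_all
  from E1[unfolded E3 E2 this]
  have "- \<i> * (LINT x|lborel. of_real (w x) / (of_real x - p)) = - (LINT x|lborel. of_real (u x) / (of_real x - p)\<^sup>2)"
    unfolding integral_mult_right_zero Bochner_Integration.integral_minus by (rule sym)
  then have "\<i> * (- \<i> * (LINT x|lborel. of_real (w x) / (of_real x - p))) = \<i> * (- (LINT x|lborel. of_real (u x) / (of_real x - p)\<^sup>2))"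
    by simp
  then show ?thesis by (simp add: mult.assoc[symmetric])
qed

lemma lebesgue_real_eq_borel_AE:
  fixes f :: "real \<Rightarrow> real"
  assumes "f \<in> borel_measurable lebesgue"
  obtains f' where "f' \<in> borel_measurable borel" "AE x in lebesgue. f x = f' x"
  using completion_ex_borel_measurable_real[OF assms] by (auto simp: AE_completion_iff)

lemma has_fourier_L2_AE_cong:
  assumes F: "has_fourier_L2 f g" and eq: "AE x in lebesgue. f x = f' x"
    and m: "f' \<in> borel_measurable borel"
  shows "has_fourier_L2 f' g"
proof -
  have m': "f' \<in> borel_measurable lebesgue" using m by (intro measurable_completion) simp
  have f: "square_integrable lebesgue f"
    using F by (simp add: has_fourier_L2_def square_integrable_lebesgue_iff_L2)
  have "truncated_fourier R f = truncated_fourier R f'" for R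
  proof
    fix \<xi>
    have e: "(\<lambda>x. exp (- \<i> * complex_of_real (x * \<xi>))) \<in> borel_measurable lebesgue"
      by (intro measurable_completion) simp
    have i: "indicator {- R..R} \<in> borel_measurable lebesgue" by (intro borel_measurable_indicator) simp
    show "truncated_fourier R f \<xi> = truncated_fourier R f' \<xi>"
      unfolding truncated_fourier_def set_lebesgue_integral_def
    proof (rule integral_cong_AE)
      show "(\<lambda>x. indicat_real {- R..R} x *\<^sub>R (exp (- \<i> * complex_of_real (x * \<xi>)) * f x)) \<in> borel_measurable lebesgue"
        by (intro borel_measurable_scaleR i borel_measurable_times e square_integrable_measurable f)
      show "(\<lambda>x. indicat_real {- R..R} x *\<^sub>R (exp (- \<i> * complex_of_real (x * \<xi>)) * f' x)) \<in> borel_measurable lebesgue"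
        by (intro borel_measurable_scaleR i borel_measurable_times e m')
    qed (use eq in \<open>auto elim!: eventually_mono\<close>)
  qed
  moreover have "square_integrable lebesgue f'"
    by (rule square_integrable_AE_cong[OF f eq m'])
  ultimately show ?thesis
    using F by (simp add: has_fourier_L2_def square_integrable_lebesgue_iff_L2)
qed

lemma has_multiplier_image_AE_cong:
  assumes "has_multiplier_image m f w" and "AE x in lebesgue. f x = f' x" "AE x in lebesgue. w x = w' x"
    and [measurable]: "f' \<in> borel_measurable borel" "w' \<in> borel_measurable borel"
  shows "has_multiplier_image m f' w'"
proof -
  obtain g where g: "has_fourier_L2 (\<lambda>x. of_real (f x)) g" "has_fourier_L2 (\<lambda>x. of_real (w x)) (\<lambda>\<xi>. of_real (m \<xi>) * g \<xi>)"
    using assms(1) by (auto simp: has_multiplier_image_def)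
  have "has_fourier_L2 (\<lambda>x. of_real (f' x)) g"
    by (rule has_fourier_L2_AE_cong[OF g(1)]) (use assms(2) in \<open>auto elim!: eventually_mono\<close>)
  moreover have "has_fourier_L2 (\<lambda>x. of_real (w' x)) (\<lambda>\<xi>. of_real (m \<xi>) * g \<xi>)"
    by (rule has_fourier_L2_AE_cong[OF g(2)]) (use assms(3) in \<open>auto elim!: eventually_mono\<close>)
  ultimately show ?thesis by (auto simp: has_multiplier_image_def)
qed

section \<open>The boundary function of a component\<close>

lemma L2_component:
  fixes f :: "real \<Rightarrow> real ^ 'm"
  assumes "L2 f"
  shows "L2 (\<lambda>x. complex_of_real (f x $ i))"
  unfolding L2_def
proof
  have "f \<in> borel_measurable lebesgue" using assms by (simp add: L2_def)
  then show m: "(\<lambda>x. complex_of_real (f x $ i)) \<in> borel_measurable lebesgue"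
    by (rule measurable_compose) (intro borel_measurable_continuous_onI continuous_intros)
  have "integrable lebesgue (\<lambda>x. (norm (f x))\<^sup>2)" using assms by (simp add: L2_def)
  then show "integrable lebesgue (\<lambda>x. (norm (complex_of_real (f x $ i)))\<^sup>2)"
  proof (rule Bochner_Integration.integrable_bound)
    show "(\<lambda>x. (norm (complex_of_real (f x $ i)))\<^sup>2) \<in> borel_measurable lebesgue"
      by (rule measurable_compose[OF m]) simp
    show "AE x in lebesgue. norm ((norm (complex_of_real (f x $ i)))\<^sup>2) \<le> norm ((norm (f x))\<^sup>2)"
      using component_le_norm_cart[of "f _" i] by (auto simp: abs_le_square_iff[symmetric])
  qed
qed

text \<open>
  Above the real line the Cauchy transforms of \<open>v\<close> and of \<open>\<i> w\<close> both equal \<open>\<integral> u x / (x - p)\<^sup>2 dx\<close>.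
  Below it, conjugation, applied to the real functions \<open>v\<close> and \<open>w\<close>, makes them opposite.
\<close>
lemma hardy_boundary_function_borel:
  fixes u v w :: "real \<Rightarrow> real" and p :: complex
  assumes weak: "\<And>\<phi>. test_function \<phi> \<Longrightarrow>
      (LINT x|lborel. deriv \<phi> x * u x) = - (LINT x|lborel. \<phi> x * v x)"
    and H: "has_multiplier_image (\<lambda>\<xi>. \<bar>\<xi>\<bar>) u w"
    and u: "square_integrable lborel (\<lambda>x. complex_of_real (u x))"
    and v: "square_integrable lborel (\<lambda>x. complex_of_real (v x))"
    and w: "square_integrable lborel (\<lambda>x. complex_of_real (w x))"
  defines "h \<equiv> \<lambda>x. Complex (v x) (w x)"
  shows "square_integrable lborel h"
    and "Im p < 0 \<Longrightarrow> cauchy_transform h p = 0"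
    and "Im p > 0 \<Longrightarrow> cauchy_transform h p = 2 * (LINT x|lborel. u x / (of_real x - p)\<^sup>2)"
proof -
  have meas: "u \<in> borel_measurable borel" "w \<in> borel_measurable borel"
    using measurable_compose[OF square_integrable_measurable[OF u] borel_measurable_Re]
      measurable_compose[OF square_integrable_measurable[OF w] borel_measurable_Re] by simp_all
  have h: "h = (\<lambda>x. of_real (v x) + \<i> * of_real (w x))"
    by (rule ext) (simp add: h_def complex_eq_iff)
  show "square_integrable lborel h"
    unfolding h by (intro square_integrable_add square_integrable_cmult v w)
  have split: "cauchy_transform h p = (LINT x|lborel. v x / (of_real x - p)) + \<i> * (LINT x|lborel. w x / (of_real x - p))"
    if "Im p \<noteq> 0" for p :: complex
  proof -
    have "cauchy_transform h p = (LINT x|lborel. of_real (v x) / (of_real x - p) + \<i> * (of_real (w x) / (of_real x - p)))"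
      unfolding cauchy_transform_def h by (simp add: add_divide_distrib)
    also have "\<dots> = (LINT x|lborel. v x / (of_real x - p)) + (LINT x|lborel. \<i> * (of_real (w x) / (of_real x - p)))"
      using that by (intro Bochner_Integration.integral_add integrable_mult_right integrable_divide_shift v w)
    finally show ?thesis unfolding integral_mult_right_zero .
  qed
  have V: "(LINT x|lborel. v x / (of_real x - p)) = (LINT x|lborel. u x / (of_real x - p)\<^sup>2)" if "Im p > 0" for p :: complex
    using that by (intro weak_derivative_cauchy_kernel weak u v) auto
  have W: "(LINT x|lborel. w x / (of_real x - p)) = - \<i> * (LINT x|lborel. u x / (of_real x - p)\<^sup>2)" if "Im p > 0" for p :: complex
    by (rule half_laplacian_cauchy_kernel[OF H meas that])
  show "cauchy_transform h p = 2 * (LINT x|lborel. u x / (of_real x - p)\<^sup>2)" if "Im p > 0"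
    using that by (simp add: split V W mult.assoc[symmetric])
  have conj: "(LINT x|lborel. of_real (r x) / (of_real x - p)) = cnj (LINT x|lborel. of_real (r x) / (of_real x - cnj p))" for r :: "real \<Rightarrow> real" and p :: complex
    by (subst Bochner_Integration.integral_cnj[symmetric]) simp
  show "cauchy_transform h p = 0" if "Im p < 0"
  proof -
    have "(LINT x|lborel. of_real (v x) / (of_real x - p)) = cnj (LINT x|lborel. u x / (of_real x - cnj p)\<^sup>2)"
      using that by (subst conj) (simp add: V)
    moreover have "(LINT x|lborel. of_real (w x) / (of_real x - p)) = cnj (- \<i> * (LINT x|lborel. u x / (of_real x - cnj p)\<^sup>2))"
      using that by (subst conj) (simp add: W)
    ultimately show ?thesis
      using that by (simp add: split mult.assoc[symmetric])
  qed
qed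

text \<open>
  The passage to Borel representatives of \<open>u\<close>, \<open>v\<close> and \<open>w\<close>.  Products such as \<open>g s \<cdot> k (s + d y)\<close> of
  Lebesgue measurable functions need not be measurable for the product measure, so the Hardy
  space argument uses Borel functions.
\<close>
lemma hardy_boundary_function:
  fixes u v w :: "real \<Rightarrow> real"
  assumes weak: "\<And>\<phi>. test_function \<phi> \<Longrightarrow>
      (LINT x|lebesgue. deriv \<phi> x * u x) = - (LINT x|lebesgue. \<phi> x * v x)"
    and H: "has_multiplier_image (\<lambda>\<xi>. \<bar>\<xi>\<bar>) u w"
    and v: "L2 (\<lambda>x. complex_of_real (v x))"
  shows "\<exists>h. square_integrable lborel h \<and> (\<forall>p. Im p < 0 \<longrightarrow> cauchy_transform h p = 0) \<and>
      (\<forall>p. Im p > 0 \<longrightarrow>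
        cauchy_transform h p = 2 * (LINT x|lebesgue. complex_of_real (u x) / (of_real x - p)\<^sup>2)) \<and>
      (AE x in lborel. h x = Complex (v x) (w x))"
proof -
  have L2: "square_integrable lebesgue (\<lambda>x. complex_of_real (u x))"
    "square_integrable lebesgue (\<lambda>x. complex_of_real (v x))"
    "square_integrable lebesgue (\<lambda>x. complex_of_real (w x))"
    using H v by (auto simp: has_multiplier_image_def has_fourier_L2_def square_integrable_lebesgue_iff_L2)
  have meas: "u \<in> borel_measurable lebesgue" "v \<in> borel_measurable lebesgue" "w \<in> borel_measurable lebesgue"
    using measurable_compose[OF square_integrable_measurable[OF L2(1)] borel_measurable_Re]
      measurable_compose[OF square_integrable_measurable[OF L2(2)] borel_measurable_Re]
      measurable_compose[OF square_integrable_measurable[OF L2(3)] borel_measurable_Re] by simp_all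
  obtain U where U [measurable]: "U \<in> borel_measurable borel" and Ueq: "AE x in lebesgue. u x = U x"
    using lebesgue_real_eq_borel_AE[OF meas(1)] .
  obtain V where V [measurable]: "V \<in> borel_measurable borel" and Veq: "AE x in lebesgue. v x = V x"
    using lebesgue_real_eq_borel_AE[OF meas(2)] .
  obtain W where W [measurable]: "W \<in> borel_measurable borel" and Weq: "AE x in lebesgue. w x = W x"
    using lebesgue_real_eq_borel_AE[OF meas(3)] .
  have transfer2: "square_integrable lborel (\<lambda>x. complex_of_real (r' x))"
    if "square_integrable lebesgue (\<lambda>x. complex_of_real (r x))" "AE x in lebesgue. r x = r' x"
      and [measurable]: "r' \<in> borel_measurable borel" for r r' :: "real \<Rightarrow> real"
  proof (rule square_integrable_lebesgue_imp_lborel)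
    show "square_integrable lebesgue (\<lambda>x. complex_of_real (r' x))"
    proof (rule square_integrable_AE_cong[OF that(1)])
      show "(\<lambda>x. complex_of_real (r' x)) \<in> borel_measurable lebesgue"
        by (intro measurable_completion) simp
    qed (use that(2) in \<open>auto elim!: eventually_mono\<close>)
  qed simp
  have transfer: "(LINT x|lborel. c x * r' x) = (LINT x|lebesgue. c x * r x)"
    if "AE x in lebesgue. r x = r' x" and r: "r \<in> borel_measurable lebesgue"
      and [measurable]: "r' \<in> borel_measurable borel" "c \<in> borel_measurable borel"
    for c r r' :: "real \<Rightarrow> 'b::{real_normed_field, second_countable_topology, banach}"
  proof -
    have c: "c \<in> borel_measurable lebesgue" and r': "r' \<in> borel_measurable lebesgue"
      by (intro measurable_completion; simp)+
    have "(LINT x|lborel. c x * r' x) = (LINT x|lebesgue. c x * r' x)"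
      by (intro integral_completion[symmetric]) simp
    also have "\<dots> = (LINT x|lebesgue. c x * r x)"
      using that(1) by (intro integral_cong_AE borel_measurable_times c r r') (auto elim!: eventually_mono)
    finally show ?thesis .
  qed
  define h where "h = (\<lambda>x. Complex (V x) (W x))"
  have weak': "(LINT x|lborel. deriv \<phi> x * U x) = - (LINT x|lborel. \<phi> x * V x)" if \<phi>: "test_function \<phi>" for \<phi>
  proof -
    have "\<phi> \<in> borel_measurable borel" "deriv \<phi> \<in> borel_measurable borel"
      using test_function_continuous[OF \<phi>] by (auto intro: borel_measurable_continuous_onI)
    then show ?thesis
      using weak[OF \<phi>] transfer[OF Ueq meas(1) U] transfer[OF Veq meas(2) V] by simp
  qed
  have H': "has_multiplier_image (\<lambda>\<xi>. \<bar>\<xi>\<bar>) U W"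
    by (rule has_multiplier_image_AE_cong[OF H Ueq Weq U W])
  note * = hardy_boundary_function_borel[OF _ H' transfer2[OF L2(1) Ueq U] transfer2[OF L2(2) Veq V]
      transfer2[OF L2(3) Weq W], folded h_def]
  show ?thesis
  proof (intro exI[of _ h] conjI allI impI)
    show "square_integrable lborel h" by (rule *(1)) (rule weak')
    show "cauchy_transform h p = 0" if "Im p < 0" for p :: complex
      by (rule *(2)[OF _ that]) (rule weak')
    show "cauchy_transform h p = 2 * (LINT x|lebesgue. u x / (of_real x - p)\<^sup>2)" if "Im p > 0" for p :: complex
    proof -
      have "(LINT x|lborel. (1 / (of_real x - p)\<^sup>2) * complex_of_real (U x)) = (LINT x|lebesgue. (1 / (of_real x - p)\<^sup>2) * complex_of_real (u x))"
        by (rule transfer) (use Ueq meas(1) in \<open>auto elim!: eventually_mono intro!: borel_measurable_of_real\<close>)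
      moreover have "cauchy_transform h p = 2 * (LINT x|lborel. U x / (of_real x - p)\<^sup>2)"
        by (rule *(3)[OF _ that]) (rule weak')
      ultimately show ?thesis by simp
    qed
    show "AE x in lborel. h x = Complex (v x) (w x)"
      using Veq Weq unfolding AE_completion_iff h_def by eventually_elim simp
  qed
qed

section \<open>The identity\<close>

theorem theorem1p3:
  fixes u u' Hu :: "real \<Rightarrow> real ^ 'm" and u\<^sub>0 :: "real ^ 'm" and t :: real
  assumes "sobolev_W12 u"
    and "has_weak_derivative u u'"
    and "has_half_laplacian u Hu"
    and "AE x in lebesgue. u' x \<bullet> Hu x = 0"
    and "integrable lebesgue (\<lambda>x. norm (u x - u\<^sub>0))"
    and "integrable lebesgue (\<lambda>x. norm (u' x))"
    and "t > 0"
  shows "(norm (LINT x|lebesgue. ((x\<^sup>2 - t\<^sup>2) / (x\<^sup>2 + t\<^sup>2)\<^sup>2) *\<^sub>R u x))\<^sup>2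
       = (norm (LINT x|lebesgue. (2 * x * t / (x\<^sup>2 + t\<^sup>2)\<^sup>2) *\<^sub>R u x))\<^sup>2"
proof -
  obtain v where v: "L2 v" "has_weak_derivative u v"
    using assms(1) by (auto simp: sobolev_W12_def)
  have uv: "AE x in lebesgue. u' x = v x"
    by (rule weak_derivative_unique[OF assms(2) v(2)])
  define boundary where "boundary i h \<longleftrightarrow>
      square_integrable lborel h \<and> (\<forall>p. Im p < 0 \<longrightarrow> cauchy_transform h p = 0) \<and>
      (\<forall>p. Im p > 0 \<longrightarrow>
        cauchy_transform h p = 2 * (LINT x|lebesgue. complex_of_real (u x $ i) / (of_real x - p)\<^sup>2)) \<and>
      (AE x in lborel. h x = Complex (v x $ i) (Hu x $ i))" for i h
  have "\<exists>h. boundary i h" for i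
    unfolding boundary_def
  proof (rule hardy_boundary_function)
    show "(LINT x|lebesgue. deriv \<phi> x * (u x $ i)) = - (LINT x|lebesgue. \<phi> x * (v x $ i))"
      if "test_function \<phi>" for \<phi>
      by (rule weak_derivative_component[OF v(2) that])
    show "has_multiplier_image (\<lambda>\<xi>. \<bar>\<xi>\<bar>) (\<lambda>x. u x $ i) (\<lambda>x. Hu x $ i)"
      using assms(3) by (simp add: has_half_laplacian_def)
    show "L2 (\<lambda>x. complex_of_real (v x $ i))" by (rule L2_component[OF v(1)])
  qed
  then obtain h where "\<And>i. boundary i (h i)" by metis
  then have h: "\<And>i. square_integrable lborel (h i)"
    and h_lower: "\<And>i p. Im p < 0 \<Longrightarrow> cauchy_transform (h i) p = 0"
    and h_upper: "\<And>i p. Im p > 0 \<Longrightarrow>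
      cauchy_transform (h i) p = 2 * (LINT x|lebesgue. complex_of_real (u x $ i) / (of_real x - p)\<^sup>2)"
    and h_AE: "\<And>i. AE x in lborel. h i x = Complex (v x $ i) (Hu x $ i)"
    unfolding boundary_def by blast+
  have square: "2 * pi * \<i> * cauchy_transform (\<lambda>x. h i x * h i x) z = (cauchy_transform (h i) z)\<^sup>2"
    if "Im z \<noteq> 0" for i z
    using cauchy_transform_mult[OF h h h_lower h_lower that] by (simp add: power2_eq_square)
  define z where "z = \<i> * complex_of_real t"
  have z: "Im z > 0" "Im (cnj z) < 0" using \<open>t > 0\<close> by (simp_all add: z_def)
  \<comment> \<open>the Cauchy transform of the bilinear square of \<open>h\<close>; it vanishes at \<open>cnj z\<close> by the product formula and,
     as the square is real almost everywhere, also at \<open>z\<close>\<close>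
  define S where "S p = (LINT x|lborel. (\<Sum>i\<in>UNIV. h i x * h i x) / (of_real x - p))" for p
  have S: "S p = (\<Sum>i\<in>UNIV. cauchy_transform (\<lambda>x. h i x * h i x) p)" if "Im p \<noteq> 0" for p
  proof -
    have "integrable lborel (\<lambda>x. h i x * h i x / (of_real x - p))" for i
      using integrable_mult_square_integrable[OF h square_integrable_divide_shift[OF h that]] by simp
    then show ?thesis
      unfolding S_def cauchy_transform_def sum_divide_distrib by (intro Bochner_Integration.integral_sum)
  qed
  have "S (cnj z) = 0"
  proof -
    have "cauchy_transform (\<lambda>x. h i x * h i x) (cnj z) = 0" for i
      using square[of "cnj z" i] h_lower[OF z(2), of i] z(2) by simp
    then show ?thesis using z by (subst S) auto
  qed
  moreover have "S z = cnj (S (cnj z))"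
    unfolding S_def Bochner_Integration.integral_cnj[symmetric]
  proof (rule integral_cong_AE)
    have [measurable]: "h i \<in> borel_measurable borel" for i
      using square_integrable_measurable[OF h[of i]] by simp
    show "(\<lambda>x. (\<Sum>i\<in>UNIV. h i x * h i x) / (of_real x - z)) \<in> borel_measurable lborel"
      by measurable
    show "(\<lambda>x. cnj ((\<Sum>i\<in>UNIV. h i x * h i x) / (of_real x - cnj z))) \<in> borel_measurable lborel"
      by (intro borel_measurable_continuous_on[OF continuous_on_cnj[OF continuous_on_id]]) measurable
    have "AE x in lborel. \<forall>i. h i x = Complex (v x $ i) (Hu x $ i)"
      using h_AE by (simp add: AE_all_countable)
    moreover have "AE x in lborel. v x \<bullet> Hu x = 0"
      using uv assms(4) unfolding AE_completion_iff by eventually_elim simp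
    ultimately show "AE x in lborel. (\<Sum>i\<in>UNIV. h i x * h i x) / (of_real x - z)
        = cnj ((\<Sum>i\<in>UNIV. h i x * h i x) / (of_real x - cnj z))"
    proof eventually_elim
      case (elim x)
      have "Im (\<Sum>i\<in>UNIV. h i x * h i x) = (\<Sum>i\<in>UNIV. 2 * (v x $ i * Hu x $ i))"
        using elim(1) by (simp add: mult.commute)
      also have "\<dots> = 2 * (v x \<bullet> Hu x)"
        by (simp add: inner_vec_def sum_distrib_left)
      finally have "Im (\<Sum>i\<in>UNIV. h i x * h i x) = 0" using elim(2) by simp
      moreover define q where "q = (\<Sum>i\<in>UNIV. h i x * h i x)"
      ultimately have "cnj q = q" by (simp add: complex_eq_iff)
      then show ?case unfolding q_def[symmetric] by simp
    qed
  qed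
  ultimately have "S z = 0" by simp
  define D where "D i = (LINT x|lebesgue. (u x $ i) / (of_real x - z)\<^sup>2)" for i
  have "(\<Sum>i\<in>UNIV. (D i)\<^sup>2) = 0"
  proof -
    have D: "(2 * D i)\<^sup>2 = 2 * pi * \<i> * cauchy_transform (\<lambda>x. h i x * h i x) z" for i
      using z(1) unfolding D_def h_upper[OF z(1), symmetric] by (intro square[symmetric]) simp
    have Sz: "S z = (\<Sum>i\<in>UNIV. cauchy_transform (\<lambda>x. h i x * h i x) z)"
      using z(1) by (intro S) simp
    have "(\<Sum>i\<in>UNIV. (2 * D i)\<^sup>2) = 2 * pi * \<i> * S z"
      unfolding D Sz sum_distrib_left ..
    then have "4 * (\<Sum>i\<in>UNIV. (D i)\<^sup>2) = 0"
      using \<open>S z = 0\<close> by (simp add: power_mult_distrib sum_distrib_left)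
    then show ?thesis by simp
  qed
  then have "Re (\<Sum>i\<in>UNIV. (D i)\<^sup>2) = 0" by simp
  then have sums: "(\<Sum>i\<in>UNIV. (Re (D i))\<^sup>2) = (\<Sum>i\<in>UNIV. (Im (D i))\<^sup>2)"
    by (simp add: power2_eq_square sum_subtractf)
  define \<kappa> where "\<kappa> x = 1 / (complex_of_real x - z)\<^sup>2" for x
  have \<kappa>: "Re (\<kappa> x) = (x\<^sup>2 - t\<^sup>2) / (x\<^sup>2 + t\<^sup>2)\<^sup>2" "Im (\<kappa> x) = 2 * x * t / (x\<^sup>2 + t\<^sup>2)\<^sup>2" for x
  proof -
    have nz: "complex_of_real x - z \<noteq> 0" "complex_of_real x + z \<noteq> 0"
      using \<open>t > 0\<close> by (auto simp: z_def complex_eq_iff)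
    have "(complex_of_real x - z) * (of_real x + z) = of_real (x\<^sup>2 + t\<^sup>2)"
      by (simp add: z_def algebra_simps power2_eq_square)
    then have eq: "(complex_of_real x - z)\<^sup>2 * (of_real x + z)\<^sup>2 = of_real ((x\<^sup>2 + t\<^sup>2)\<^sup>2)"
      by (simp flip: power_mult_distrib)
    have "\<kappa> x = (of_real x + z)\<^sup>2 / of_real ((x\<^sup>2 + t\<^sup>2)\<^sup>2)"
      using nz unfolding \<kappa>_def eq[symmetric] by simp
    moreover have "(of_real x + z)\<^sup>2 = Complex (x\<^sup>2 - t\<^sup>2) (2 * x * t)"
      by (simp add: z_def complex_eq_iff power2_eq_square algebra_simps)
    ultimately have "\<kappa> x = Complex (x\<^sup>2 - t\<^sup>2) (2 * x * t) / of_real ((x\<^sup>2 + t\<^sup>2)\<^sup>2)" by simp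
    then show "Re (\<kappa> x) = (x\<^sup>2 - t\<^sup>2) / (x\<^sup>2 + t\<^sup>2)\<^sup>2" "Im (\<kappa> x) = 2 * x * t / (x\<^sup>2 + t\<^sup>2)\<^sup>2"
      by (simp_all only: Re_divide_of_real Im_divide_of_real complex.sel)
  qed
  have z0: "Im z \<noteq> 0" using z by simp
  have \<kappa>2: "square_integrable lebesgue \<kappa>"
    using square_integrable_lborel_imp_lebesgue[OF square_integrable_divide_shift[OF square_integrable_cauchy_kernel[OF z0] z0]]
    by (simp add: \<kappa>_def[abs_def] power2_eq_square)
  have u: "L2 u" using assms(1) by (simp add: sobolev_W12_def)
  have int: "integrable lebesgue (\<lambda>x. r (\<kappa> x) *\<^sub>R u x)" if "r \<in> borel_measurable borel" "\<And>w. \<bar>r w\<bar> \<le> norm w" for r :: "complex \<Rightarrow> real"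
  proof (rule Bochner_Integration.integrable_bound)
    have "square_integrable lebesgue (\<lambda>x. complex_of_real (norm (u x)))"
      using u by (auto simp: L2_def square_integrable_def)
    from integrable_mult_square_integrable[OF \<kappa>2 this]
    show "integrable lebesgue (\<lambda>x. \<kappa> x * complex_of_real (norm (u x)))" .
    show "(\<lambda>x. r (\<kappa> x) *\<^sub>R u x) \<in> borel_measurable lebesgue"
      using u that(1) by (intro borel_measurable_scaleR measurable_compose[OF square_integrable_measurable[OF \<kappa>2]]) (auto simp: L2_def)
    show "AE x in lebesgue. norm (r (\<kappa> x) *\<^sub>R u x) \<le> norm (\<kappa> x * complex_of_real (norm (u x)))"
      using that(2) by (auto simp: norm_mult intro!: mult_right_mono)
  qed
  have intD: "integrable lebesgue (\<lambda>x. (u x $ i) / (of_real x - z)\<^sup>2)" for i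
    using integrable_mult_square_integrable[OF \<kappa>2 L2_component[OF u, of i, folded square_integrable_lebesgue_iff_L2]]
    by (simp add: \<kappa>_def)
  have A: "(LINT x|lebesgue. Re (\<kappa> x) *\<^sub>R u x) $ i = Re (D i)" for i
  proof -
    have "(LINT x|lebesgue. Re (\<kappa> x) *\<^sub>R u x) $ i = (LINT x|lebesgue. (Re (\<kappa> x) *\<^sub>R u x) $ i)"
      by (intro integral_bounded_linear[OF bounded_linear_vec_nth, symmetric] int) (auto simp: abs_Re_le_cmod)
    also have "\<dots> = (LINT x|lebesgue. Re ((u x $ i) / (of_real x - z)\<^sup>2))"
      by (intro Bochner_Integration.integral_cong) (auto simp: \<kappa>_def Re_divide)
    finally show ?thesis using intD by (simp add: D_def)
  qed
  have B: "(LINT x|lebesgue. Im (\<kappa> x) *\<^sub>R u x) $ i = Im (D i)" for i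
  proof -
    have "(LINT x|lebesgue. Im (\<kappa> x) *\<^sub>R u x) $ i = (LINT x|lebesgue. (Im (\<kappa> x) *\<^sub>R u x) $ i)"
      by (intro integral_bounded_linear[OF bounded_linear_vec_nth, symmetric] int) (auto simp: abs_Im_le_cmod)
    also have "\<dots> = (LINT x|lebesgue. Im ((u x $ i) / (of_real x - z)\<^sup>2))"
      by (intro Bochner_Integration.integral_cong) (auto simp: \<kappa>_def Im_divide)
    finally show ?thesis using intD by (simp add: D_def)
  qed
  have norm2: "(norm w)\<^sup>2 = (\<Sum>i\<in>UNIV. (w $ i)\<^sup>2)" for w :: "real ^ 'm"
    unfolding power2_norm_eq_inner inner_vec_def by (simp add: power2_eq_square)
  show ?thesis
    unfolding \<kappa>[symmetric] norm2 A B by (rule sums)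
qed

end
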